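(* Let $n\ge 3$. The space $\mathscr{L}(n)$ of shapes of $n$-segments without labelled vertices is homeomorphic to the spherical orbifold $\mathbb{S}^{n-2}/\langle\mathcal{R}_n,\nu\rangle$, where $\mathbb{S}^{n-2}\subset\mathbb{R}^{n-1}$ is the unit sphere and $\nu(X)=-X$.
   Context: Let $n\ge3$ and $\mathcal{D}_n=\{(b,\dots,b): b\in\mathbb{C}\}\subset\mathbb{C}^n$. $\mathbb{L}(n)$ is the set of $(z_1,\dots,z_n)\in\mathbb{C}^n\smallsetminus\mathcal{D}_n$ such that $z_1,\dots,z_n$ lie on a common real straight line in $\mathbb{C}$. The complex affine group $\mathcal{A}_{\mathbb{C}}=\{z\mapsto az+b : a\in\mathbb{C}\smallsetminus\{0\},b\in\mathbb{C}\}$ acts diagonally on $\mathbb{C}^n$ by $(z_1,\dots,z_n)\mapsto(az_1+b,\dots,az_n+b)$; let $P(n)=(\mathbb{C}^n\smallsetminus\mathcal{D}_n)/\mathcal{A}_{\mathbb{C}}$ with natural projection $\eta\colon\mathbb{C}^n\smallsetminus\mathcal{D}_n\to P(n)$. The map $M(z_1,z_2,\dots,z_n)=(z_2,\dots,z_n,z_1)$ induces a diffeomorphism $\mu\colon P(n)\to P(n)$ with $\mu\circ\eta=\eta\circ M$, and $\mu$ preserves $\eta(\mathbb{L}(n))$. Then $\mathscr{L}(n):=\eta(\mathbb{L}(n))/\langle\mu\rangle$ with the quotient topology. Let $R_\theta\in GL_2(\mathbb{R})$ be the counterclockwise rotation matrix of angle $\theta$. $\mathcal{R}_n\in GL_{n-1}(\mathbb{R})$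 is the block-diagonal matrix with diagonal blocks $R_{1\cdot\frac{2\pi}{n}},R_{2\cdot\frac{2\pi}{n}},\dots,R_{\frac{n-1}{2}\cdot\frac{2\pi}{n}}$ if $n$ is odd, and $R_{1\cdot\frac{2\pi}{n}},R_{2\cdot\frac{2\pi}{n}},\dots,R_{\frac{n-2}{2}\cdot\frac{2\pi}{n}},-1$ if $n$ is even (last block of size $1$). $\langle\mathcal{R}_n,\nu\rangle$ is the (finite) subgroup of the orthogonal group $O(n-1)$ generated by $\mathcal{R}_n$ and $\nu$. A spherical orbifold is the quotient of a unit sphere by a finite group of orthogonal transformations. *)

theory Defs
  imports
    "HOL-Analysis.Analysis"
    "HOL-Algebra.Group_Action"
    "HOL-Algebra.Generated_Groups"
    "Jordan_Normal_Form.Determinant"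
begin

section \<open>Orbit spaces\<close>

definition quotient_topology :: "'a topology \<Rightarrow> ('a \<Rightarrow> 'b) \<Rightarrow> 'b topology" where
  "quotient_topology X f =
     topology (\<lambda>U. U \<subseteq> f ` topspace X \<and> openin X {x \<in> topspace X. f x \<in> U})"

lemma openin_quotient_topology:
  "openin (quotient_topology X f) U \<longleftrightarrow>
     U \<subseteq> f ` topspace X \<and> openin X {x \<in> topspace X. f x \<in> U}"
proof -
  have "istopology (\<lambda>U. U \<subseteq> f ` topspace X \<and> openin X {x \<in> topspace X. f x \<in> U})"
    unfolding istopology_def
  proof (intro conjI allI impI; (elim conjE)?)
    fix S T assume *: "openin X {x \<in> topspace X. f x \<in> S}" "openin X {x \<in> topspace X. f x \<in> T}"
    have "{x \<in> topspace X. f x \<in> S \<inter> T} = {x \<in> topspace X. f x \<in> S} \<inter> {x \<in> topspace X. f x \<in> T}"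
      by blast
    with * show "openin X {x \<in> topspace X. f x \<in> S \<inter> T}" by auto
  next
    fix K assume *: "\<forall>U\<in>K. U \<subseteq> f ` topspace X \<and> openin X {x \<in> topspace X. f x \<in> U}"
    have "{x \<in> topspace X. f x \<in> \<Union>K} = (\<Union>U\<in>K. {x \<in> topspace X. f x \<in> U})" by blast
    with * show "openin X {x \<in> topspace X. f x \<in> \<Union>K}" by auto
  qed auto
  then show ?thesis by (simp add: quotient_topology_def)
qed

lemma topspace_quotient_topology: "topspace (quotient_topology X f) = f ` topspace X"
proof -
  have "{x \<in> topspace X. f x \<in> f ` topspace X} = topspace X" by auto
  then have "openin (quotient_topology X f) (f ` topspace X)"
    by (simp add: openin_quotient_topology)
  then show ?thesis
    by (meson openin_quotient_topology openin_subset openin_topspace subset_antisym)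
qed

lemma quotient_map_quotient_topology: "quotient_map X (quotient_topology X f) f"
  by (auto simp: quotient_map_def topspace_quotient_topology openin_quotient_topology)

definition orbit_space ::
  "('g, 'm) monoid_scheme \<Rightarrow> ('g \<Rightarrow> 'a \<Rightarrow> 'a) \<Rightarrow> 'a topology \<Rightarrow> 'a set topology" where
  "orbit_space G \<phi> X = quotient_topology X (orbit G \<phi>)"


section \<open>Shapes of labelled polygons\<close>

text \<open>A point of \<open>\<complex>\<^sup>n\<close> is a function on the index set \<open>{..<n}\<close>, extended by \<open>undefined\<close>;
  the coordinates are numbered from \<open>0\<close>.\<close>

definition complex_space :: "nat \<Rightarrow> (nat \<Rightarrow> complex) topology" where
  "complex_space n = product_topology (\<lambda>_. euclidean) {..<n}"

definition diag_points :: "nat \<Rightarrow> (nat \<Rightarrow> complex) set" where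
  "diag_points n = {\<lambda>i\<in>{..<n}. b | b. True}"

definition polygons :: "nat \<Rightarrow> (nat \<Rightarrow> complex) topology" where
  "polygons n = subtopology (complex_space n) (- diag_points n)"

definition affine_group :: "(complex \<Rightarrow> complex) monoid" where
  "affine_group = \<lparr>carrier = {\<lambda>z. a * z + b | a b. a \<noteq> 0}, mult = (\<circ>), one = id\<rparr>"

definition affine_act :: "nat \<Rightarrow> (complex \<Rightarrow> complex) \<Rightarrow> (nat \<Rightarrow> complex) \<Rightarrow> nat \<Rightarrow> complex" where
  "affine_act n g z = (\<lambda>i\<in>{..<n}. g (z i))"

definition P_space :: "nat \<Rightarrow> (nat \<Rightarrow> complex) set topology" where
  "P_space n = orbit_space affine_group (affine_act n) (polygons n)"

definition eta :: "nat \<Rightarrow> (nat \<Rightarrow> complex) \<Rightarrow> (nat \<Rightarrow> complex) set" where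
  "eta n = orbit affine_group (affine_act n)"

definition segments :: "nat \<Rightarrow> (nat \<Rightarrow> complex) set" where
  "segments n = {z \<in> topspace (polygons n). collinear (z ` {..<n})}"


section \<open>Forgetting the labels\<close>

definition cyc :: "nat \<Rightarrow> (nat \<Rightarrow> complex) \<Rightarrow> nat \<Rightarrow> complex" where
  "cyc n z = (\<lambda>i\<in>{..<n}. z (Suc i mod n))"

text \<open>Since \<open>cyc n\<close> commutes with the affine action, it maps orbits onto orbits, so the induced
  map is the image map; the equation \<open>\<mu> \<circ> \<eta> = \<eta> \<circ> M\<close> is lemma \<open>mu_eta\<close> below.
  It is made extensional because \<^const>\<open>BijGroup\<close> requires this.\<close>

definition mu :: "nat \<Rightarrow> (nat \<Rightarrow> complex) set \<Rightarrow> (nat \<Rightarrow> complex) set" where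
  "mu n = (\<lambda>p\<in>topspace (P_space n). cyc n ` p)"

definition mu_group :: "nat \<Rightarrow> ((nat \<Rightarrow> complex) set \<Rightarrow> (nat \<Rightarrow> complex) set) monoid" where
  "mu_group n = subgroup_generated (BijGroup (topspace (P_space n))) {mu n}"

definition segment_shape_space :: "nat \<Rightarrow> (nat \<Rightarrow> complex) set set topology" where
  "segment_shape_space n =
     orbit_space (mu_group n) (\<lambda>g. g) (subtopology (P_space n) (eta n ` segments n))"


section \<open>The spherical orbifold\<close>

definition orthogonal_group :: "nat \<Rightarrow> real mat monoid" where
  "orthogonal_group m =
     \<lparr>carrier = {A \<in> carrier_mat m m. transpose_mat A * A = 1\<^sub>m m}, mult = (*), one = 1\<^sub>m m\<rparr>"

definition rotation_mat :: "real \<Rightarrow> real mat" where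
  "rotation_mat \<theta> = mat_of_rows_list 2 [[cos \<theta>, - sin \<theta>], [sin \<theta>, cos \<theta>]]"

definition R_mat :: "nat \<Rightarrow> real mat" where
  "R_mat n = diag_block_mat
     (map (\<lambda>k. rotation_mat (real k * (2 * pi / real n))) [1..<Suc ((n - 1) div 2)]
      @ (if even n then [- 1\<^sub>m 1] else []))"

definition nu_mat :: "nat \<Rightarrow> real mat" where
  "nu_mat n = - 1\<^sub>m (n - 1)"

definition R_nu_group :: "nat \<Rightarrow> real mat monoid" where
  "R_nu_group n = subgroup_generated (orthogonal_group (n - 1)) {R_mat n, nu_mat n}"

text \<open>In \<^const>\<open>Euclidean_space\<close>, a point of \<open>\<real>\<^sup>m\<close> is a sequence vanishing from index \<open>m\<close> on.\<close>

definition mat_act :: "real mat \<Rightarrow> (nat \<Rightarrow> real) \<Rightarrow> nat \<Rightarrow> real" where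
  "mat_act A x = (\<lambda>i. if i < dim_row A then \<Sum>j<dim_col A. A $$ (i, j) * x j else 0)"

definition spherical_orbifold :: "nat \<Rightarrow> (nat \<Rightarrow> real) set topology" where
  "spherical_orbifold n = orbit_space (R_nu_group n) mat_act (nsphere (n - 2))"


section \<open>Well-definedness of the constructions\<close>

lemma topspace_polygons: "topspace (polygons n) = extensional {..<n} - diag_points n"
  by (auto simp: polygons_def complex_space_def PiE_def)

lemma topspace_P_space: "topspace (P_space n) = eta n ` topspace (polygons n)"
  by (simp add: P_space_def orbit_space_def topspace_quotient_topology eta_def)

lemma affine_group_carrier:
  "f \<in> carrier affine_group \<longleftrightarrow> (\<exists>a b. f = (\<lambda>z. a * z + b) \<and> a \<noteq> 0)"
  by (simp add: affine_group_def)

lemma affine_group_mult: "f \<otimes>\<^bsub>affine_group\<^esub> g = f \<circ> g"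
  by (simp add: affine_group_def)

lemma affine_group_one: "\<one>\<^bsub>affine_group\<^esub> = id"
  by (simp add: affine_group_def)

lemma eta_eq: "eta n z = {\<lambda>i\<in>{..<n}. a * z i + b | a b. a \<noteq> 0}"
proof (intro equalityI subsetI)
  fix w assume "w \<in> eta n z"
  then show "w \<in> {\<lambda>i\<in>{..<n}. a * z i + b | a b. a \<noteq> 0}"
    unfolding eta_def orbit_def affine_group_carrier affine_act_def by blast
next
  fix w assume "w \<in> {\<lambda>i\<in>{..<n}. a * z i + b | a b. a \<noteq> 0}"
  then obtain a b where w: "w = affine_act n (\<lambda>z. a * z + b) z" and "a \<noteq> 0"
    unfolding affine_act_def by blast
  then have "(\<lambda>z. a * z + b) \<in> carrier affine_group"
    unfolding affine_group_carrier by blast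
  with w show "w \<in> eta n z" unfolding eta_def orbit_def by blast
qed

lemma group_affine_group: "group affine_group"
proof (rule groupI)
  fix f g assume "f \<in> carrier affine_group" "g \<in> carrier affine_group"
  then obtain a b c d where "f = (\<lambda>z. a * z + b)" "g = (\<lambda>z. c * z + d)" "a \<noteq> 0" "c \<noteq> 0"
    unfolding affine_group_carrier by blast
  then have "f \<circ> g = (\<lambda>z. (a * c) * z + (a * d + b))" "a * c \<noteq> 0"
    by (simp_all add: fun_eq_iff algebra_simps)
  then show "f \<otimes>\<^bsub>affine_group\<^esub> g \<in> carrier affine_group"
    unfolding affine_group_carrier affine_group_mult by blast
next
  have "id = (\<lambda>z. 1 * z + (0 :: complex))" by (simp add: fun_eq_iff)
  then show "\<one>\<^bsub>affine_group\<^esub> \<in> carrier affine_group"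
    unfolding affine_group_carrier affine_group_one using zero_neq_one by metis
next
  fix f assume "f \<in> carrier affine_group"
  then obtain a b where f: "f = (\<lambda>z. a * z + b)" "a \<noteq> 0"
    unfolding affine_group_carrier by blast
  define g where "g = (\<lambda>z. inverse a * z + (- b / a))"
  have "inverse a \<noteq> 0" using f by simp
  then have "g \<in> carrier affine_group"
    unfolding affine_group_carrier g_def by blast
  moreover have "g \<circ> f = id"
    using f by (simp add: g_def fun_eq_iff field_simps)
  ultimately show "\<exists>g\<in>carrier affine_group. g \<otimes>\<^bsub>affine_group\<^esub> f = \<one>\<^bsub>affine_group\<^esub>"
    unfolding affine_group_mult affine_group_one by blast
qed (simp_all add: affine_group_mult affine_group_one o_assoc)

lemma cyc_eta: assumes "n > 0" shows "cyc n ` eta n z = eta n (cyc n z)"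
proof -
  have "cyc n (\<lambda>i\<in>{..<n}. a * z i + b) = (\<lambda>i\<in>{..<n}. a * cyc n z i + b)" for a b
    using assms by (auto simp: cyc_def fun_eq_iff)
  moreover have "{\<lambda>i\<in>{..<n}. a * w i + b | a b. a \<noteq> 0} =
      (\<lambda>(a, b). \<lambda>i\<in>{..<n}. a * w i + b) ` ((- {0}) \<times> UNIV)" for w :: "nat \<Rightarrow> complex"
    by force
  ultimately show ?thesis by (simp add: eta_eq image_image case_prod_unfold)
qed

lemma mu_eta:
  assumes "n > 0" "z \<in> topspace (polygons n)"
  shows "mu n (eta n z) = eta n (cyc n z)"
  using assms by (simp add: mu_def topspace_P_space cyc_eta)

lemma bij_betw_Suc_mod: "n > 0 \<Longrightarrow> bij_betw (\<lambda>i. Suc i mod n) {..<n} {..<n}"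
proof -
  assume n: "n > 0"
  have "inj_on (\<lambda>i. Suc i mod n) {..<n}"
    by (auto simp: inj_on_def mod_Suc split: if_splits)
  moreover have "(\<lambda>i. Suc i mod n) ` {..<n} \<subseteq> {..<n}" using n by auto
  ultimately show ?thesis
    by (simp add: bij_betw_def endo_inj_surj)
qed

lemma bij_betw_cyc:
  assumes n: "n > 0"
  shows "bij_betw (cyc n) (topspace (polygons n)) (topspace (polygons n))"
proof -
  define s where "s = (\<lambda>i. Suc i mod n)"
  define t where "t = inv_into {..<n} s"
  have bs: "bij_betw s {..<n} {..<n}" unfolding s_def by (rule bij_betw_Suc_mod[OF n])
  have bt: "bij_betw t {..<n} {..<n}" unfolding t_def by (rule bij_betw_inv_into[OF bs])
  have st: "s (t i) = i" "t (s i) = i" if "i < n" for i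
    using that bs unfolding t_def
    by (auto simp: bij_betw_inv_into_right bij_betw_inv_into_left)
  have lt: "s i < n" "t i < n" if "i < n" for i
    using that bs bt by (auto dest: bij_betwE)
  have key: "z \<in> diag_points n \<longleftrightarrow> (\<lambda>i\<in>{..<n}. z (s i)) \<in> diag_points n"
    if "z \<in> extensional {..<n}" for z
  proof
    assume "z \<in> diag_points n"
    then show "(\<lambda>i\<in>{..<n}. z (s i)) \<in> diag_points n"
      using lt by (auto simp: diag_points_def fun_eq_iff)
  next
    assume "(\<lambda>i\<in>{..<n}. z (s i)) \<in> diag_points n"
    then obtain b where b: "\<And>i. i < n \<Longrightarrow> z (s i) = b"
      by (auto simp: diag_points_def fun_eq_iff split: if_splits)
    then have "z i = b" if "i < n" for i using that st lt by metis
    then have "z = (\<lambda>i\<in>{..<n}. b)" using that by (auto simp: fun_eq_iff extensional_def)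
    then show "z \<in> diag_points n" by (auto simp: diag_points_def)
  qed
  show ?thesis
  proof (rule bij_betw_byWitness[where f' = "\<lambda>z. \<lambda>i\<in>{..<n}. z (t i)"])
    show "\<forall>a\<in>topspace (polygons n). (\<lambda>i\<in>{..<n}. cyc n a (t i)) = a"
      using lt st by (auto simp: topspace_polygons cyc_def fun_eq_iff extensional_def s_def)
    show "\<forall>a\<in>topspace (polygons n). cyc n (\<lambda>i\<in>{..<n}. a (t i)) = a"
      using lt st by (auto simp: topspace_polygons cyc_def fun_eq_iff extensional_def s_def)
    show "cyc n ` topspace (polygons n) \<subseteq> topspace (polygons n)"
      using key by (auto simp: topspace_polygons cyc_def s_def)
    show "(\<lambda>z. \<lambda>i\<in>{..<n}. z (t i)) ` topspace (polygons n) \<subseteq> topspace (polygons n)"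
    proof clarify
      fix z assume z: "z \<in> topspace (polygons n)"
      have "(\<lambda>i\<in>{..<n}. (\<lambda>i\<in>{..<n}. z (t i)) (s i)) = z"
        using lt st z by (auto simp: topspace_polygons fun_eq_iff extensional_def)
      with z key[of "\<lambda>i\<in>{..<n}. z (t i)"]
      show "(\<lambda>i\<in>{..<n}. z (t i)) \<in> topspace (polygons n)"
        by (auto simp: topspace_polygons)
    qed
  qed
qed

lemma eta_subset: 
  assumes "z \<in> topspace (polygons n)" shows "eta n z \<subseteq> topspace (polygons n)"
proof
  fix w assume "w \<in> eta n z"
  then obtain a b where w: "w = (\<lambda>i\<in>{..<n}. a * z i + b)" and a: "a \<noteq> 0" by (auto simp: eta_eq)
  have "w \<notin> diag_points n"
  proof
    assume "w \<in> diag_points n"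
    then obtain c where "\<And>i. i < n \<Longrightarrow> a * z i + b = c"
      by (auto simp: diag_points_def w fun_eq_iff split: if_splits)
    then have "\<And>i. i < n \<Longrightarrow> z i = (c - b) / a" using a by (metis add_diff_cancel_right' nonzero_mult_div_cancel_left)
    then have "z = (\<lambda>i\<in>{..<n}. (c - b) / a)"
      using assms by (auto simp: topspace_polygons fun_eq_iff extensional_def)
    then have "z \<in> diag_points n" by (auto simp: diag_points_def)
    with assms show False by (simp add: topspace_polygons)
  qed
  then show "w \<in> topspace (polygons n)" by (simp add: topspace_polygons w)
qed

lemma mu_in_Bij:
  assumes n: "n > 0" shows "mu n \<in> carrier (BijGroup (topspace (P_space n)))"
proof -
  have b: "inj_on (cyc n) (topspace (polygons n))" "cyc n ` topspace (polygons n) = topspace (polygons n)"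
    using bij_betw_cyc[OF n] by (auto simp: bij_betw_def)
  have sub: "p \<subseteq> topspace (polygons n)" if "p \<in> topspace (P_space n)" for p
    using that eta_subset by (auto simp: topspace_P_space)
  have "inj_on (mu n) (topspace (P_space n))"
    using sub inj_on_image_eq_iff[OF b(1)] by (auto simp: inj_on_def mu_def)
  moreover have "mu n ` topspace (P_space n) = topspace (P_space n)"
  proof -
    have "mu n ` topspace (P_space n) = (\<lambda>z. eta n (cyc n z)) ` topspace (polygons n)"
      using mu_eta[OF n] by (force simp: topspace_P_space)
    also have "\<dots> = eta n ` cyc n ` topspace (polygons n)" by (simp add: image_image)
    finally show ?thesis by (simp only: b(2) topspace_P_space)
  qed
  ultimately show ?thesis
    by (auto simp: BijGroup_def Bij_def bij_betw_def mu_def)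
qed

lemma mu_preserves_segments:
  assumes n: "n > 0" shows "mu n ` eta n ` segments n = eta n ` segments n"
proof -
  have im: "cyc n z ` {..<n} = z ` {..<n}" for z
    using bij_betw_imp_surj_on[OF bij_betw_Suc_mod[OF n]]
    by (simp add: cyc_def image_image[symmetric, of z "\<lambda>i. Suc i mod n"])
  have "cyc n ` segments n = segments n"
  proof (intro equalityI subsetI)
    fix w assume "w \<in> cyc n ` segments n"
    then show "w \<in> segments n"
      using bij_betwE[OF bij_betw_cyc[OF n]] im by (auto simp: segments_def)
  next
    fix w assume w: "w \<in> segments n"
    then obtain z where "z \<in> topspace (polygons n)" "w = cyc n z"
      using bij_betw_imp_surj_on[OF bij_betw_cyc[OF n]] unfolding segments_def by blast
    with w im show "w \<in> cyc n ` segments n" by (auto simp: segments_def)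
  qed
  moreover have "mu n ` eta n ` segments n = eta n ` cyc n ` segments n"
    using mu_eta[OF n] by (force simp: segments_def image_image)
  ultimately show ?thesis by simp
qed

lemma group_orthogonal_group: "group (orthogonal_group m)"
proof (rule groupI)
  fix A B assume "A \<in> carrier (orthogonal_group m)" "B \<in> carrier (orthogonal_group m)"
  then have A: "A \<in> carrier_mat m m" "transpose_mat A * A = 1\<^sub>m m"
    and B: "B \<in> carrier_mat m m" "transpose_mat B * B = 1\<^sub>m m"
    by (auto simp: orthogonal_group_def)
  have "transpose_mat (A * B) * (A * B) = transpose_mat B * (transpose_mat A * A) * B"
    using A(1) B(1) by (simp add: transpose_mult[OF A(1) B(1)] assoc_mult_mat[of _ m m _ m _ m])
  also have "\<dots> = 1\<^sub>m m" using A B by simp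
  finally show "A \<otimes>\<^bsub>orthogonal_group m\<^esub> B \<in> carrier (orthogonal_group m)"
    using A B by (simp add: orthogonal_group_def)
next
  fix A assume "A \<in> carrier (orthogonal_group m)"
  then have A: "A \<in> carrier_mat m m" "transpose_mat A * A = 1\<^sub>m m"
    by (auto simp: orthogonal_group_def)
  then have "A * transpose_mat A = 1\<^sub>m m"
    using mat_mult_left_right_inverse[of "transpose_mat A" m A] by simp
  then show "\<exists>B\<in>carrier (orthogonal_group m). B \<otimes>\<^bsub>orthogonal_group m\<^esub> A = \<one>\<^bsub>orthogonal_group m\<^esub>"
    using A by (intro bexI[of _ "transpose_mat A"]) (auto simp: orthogonal_group_def)
qed (auto simp: orthogonal_group_def)

lemma orthogonal_group_carrier:
  "A \<in> carrier (orthogonal_group m) \<longleftrightarrow> A \<in> carrier_mat m m \<and> transpose_mat A * A = 1\<^sub>m m"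
  by (simp add: orthogonal_group_def)

lemma diag_block_orthogonal:
  assumes "\<And>A. A \<in> set As \<Longrightarrow> A \<in> carrier (orthogonal_group (dim_row A))"
  shows "diag_block_mat As \<in> carrier (orthogonal_group (sum_list (map dim_row As)))"
  using assms
proof (induction As)
  case Nil
  then show ?case by (auto simp: orthogonal_group_carrier intro!: eq_matI)
next
  case (Cons A As)
  define m where "m = dim_row A"
  define l where "l = sum_list (map dim_row As)"
  define B where "B = diag_block_mat As"
  have A: "A \<in> carrier_mat m m" "transpose_mat A * A = 1\<^sub>m m"
    using Cons.prems[of A] by (auto simp: orthogonal_group_carrier m_def)
  have B: "B \<in> carrier_mat l l" "transpose_mat B * B = 1\<^sub>m l"
    using Cons by (auto simp: orthogonal_group_carrier B_def l_def)
  have eq: "diag_block_mat (A # As) = four_block_mat A (0\<^sub>m m l) (0\<^sub>m l m) B"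
    using A(1) B(1) by (simp add: B_def[symmetric] Let_def)
  have "transpose_mat (four_block_mat A (0\<^sub>m m l) (0\<^sub>m l m) B) =
      four_block_mat (transpose_mat A) (0\<^sub>m m l) (0\<^sub>m l m) (transpose_mat B)"
    using transpose_four_block_mat[OF A(1) zero_carrier_mat zero_carrier_mat B(1)] by simp
  then have "transpose_mat (diag_block_mat (A # As)) * diag_block_mat (A # As) = 1\<^sub>m (m + l)"
    unfolding eq using A B by (simp add: mult_four_block_mat[of _ m m _ l _ l _ _ m _ l] four_block_one_mat)
  then show ?case
    unfolding orthogonal_group_carrier eq using A(1) B(1)
    by (simp add: m_def[symmetric] l_def[symmetric])
qed

lemma rotation_mat_carrier: "rotation_mat \<theta> \<in> carrier_mat 2 2"
  by (simp add: rotation_mat_def mat_of_rows_list_def numeral_2_eq_2)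

lemma rotation_mat_index:
  "rotation_mat \<theta> $$ (0, 0) = cos \<theta>" "rotation_mat \<theta> $$ (0, 1) = - sin \<theta>"
  "rotation_mat \<theta> $$ (1, 0) = sin \<theta>" "rotation_mat \<theta> $$ (1, 1) = cos \<theta>"
  by (simp_all add: rotation_mat_def mat_of_rows_list_def)

lemma mat_2_eqI:
  assumes "A \<in> carrier_mat 2 2" "B \<in> carrier_mat 2 2" "A $$ (0, 0) = B $$ (0, 0)"
    "A $$ (0, 1) = B $$ (0, 1)" "A $$ (1, 0) = B $$ (1, 0)" "A $$ (1, 1) = B $$ (1, 1)"
  shows "A = B"
  using assms by (intro eq_matI) (auto simp: less_2_cases_iff)

lemma mat_2_mult_index:
  assumes "A \<in> carrier_mat 2 2" "B \<in> carrier_mat 2 2" "i < 2" "j < 2"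
  shows "(A * B) $$ (i, j) = A $$ (i, 0) * B $$ (0, j) + A $$ (i, 1) * B $$ (1, j)"
proof -
  have "{0..<2::nat} = {0, 1}" by auto
  then show ?thesis using assms by (simp add: scalar_prod_def)
qed

lemma rotation_mat_add: "rotation_mat a * rotation_mat b = rotation_mat (a + b)"
  using rotation_mat_carrier
  by (intro mat_2_eqI)
    (simp_all add: mult_carrier_mat[of _ 2 2 _ 2] mat_2_mult_index rotation_mat_index
      rotation_mat_index[unfolded One_nat_def] cos_add sin_add algebra_simps)

lemma rotation_mat_0: "rotation_mat 0 = 1\<^sub>m 2"
  by (rule mat_2_eqI) (simp_all add: rotation_mat_carrier rotation_mat_index[unfolded One_nat_def])

lemma transpose_rotation_mat: "transpose_mat (rotation_mat \<theta>) = rotation_mat (- \<theta>)"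
  by (rule mat_2_eqI)
    (simp_all add: rotation_mat_carrier index_transpose_mat carrier_matD[OF rotation_mat_carrier]
      rotation_mat_index[unfolded One_nat_def])

lemma rotation_mat_orthogonal: "rotation_mat \<theta> \<in> carrier (orthogonal_group 2)"
  by (simp add: orthogonal_group_carrier rotation_mat_carrier transpose_rotation_mat
      rotation_mat_add rotation_mat_0)

lemma R_mat_orthogonal:
  assumes "n > 0" shows "R_mat n \<in> carrier (orthogonal_group (n - 1))"
proof -
  define As where "As = map (\<lambda>k. rotation_mat (real k * (2 * pi / real n))) [1..<Suc ((n - 1) div 2)]
      @ (if even n then [- 1\<^sub>m 1] else [])"
  have d: "dim_row (rotation_mat \<theta>) = 2" for \<theta>
    using rotation_mat_carrier[of \<theta>] by simp
  have "A \<in> carrier (orthogonal_group (dim_row A))" if "A \<in> set As" for A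
  proof -
    have "- 1\<^sub>m 1 \<in> carrier (orthogonal_group 1)"
      by (auto simp: orthogonal_group_carrier scalar_prod_def intro!: eq_matI)
    with that show ?thesis
      using d rotation_mat_orthogonal by (auto simp: As_def split: if_splits)
  qed
  moreover have "sum_list (map dim_row As) = n - 1"
  proof -
    have "sum_list (map dim_row As) = (n - 1) div 2 * 2 + (if even n then 1 else 0)"
      by (simp add: As_def d o_def sum_list_triv del: upt_Suc)
    then show ?thesis using assms by presburger
  qed
  moreover have "R_mat n = diag_block_mat As" by (simp add: R_mat_def As_def)
  ultimately show ?thesis using diag_block_orthogonal[of As] by metis
qed

lemma nu_mat_orthogonal: "nu_mat n \<in> carrier (orthogonal_group (n - 1))"
  by (auto simp: orthogonal_group_carrier nu_mat_def)

lemma mat_act_nu_mat: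
  assumes "x \<in> topspace (Euclidean_space (n - 1))"
  shows "mat_act (nu_mat n) x = (\<lambda>i. - x i)"
proof
  fix i
  show "mat_act (nu_mat n) x i = - x i"
  proof (cases "i < n - 1")
    case True
    have "(\<Sum>j<n-1. (if i = j then - 1 else 0) * x j) = - x i"
      using True by (subst sum.remove[of _ i]) (auto intro!: sum.neutral)
    moreover have "(\<Sum>j<n-1. nu_mat n $$ (i, j) * x j) = (\<Sum>j<n-1. (if i = j then - 1 else 0) * x j)"
      using True by (intro sum.cong) (auto simp: nu_mat_def)
    ultimately show ?thesis using True by (simp add: mat_act_def nu_mat_def)
  next
    case False
    with assms show ?thesis by (simp add: mat_act_def nu_mat_def topspace_Euclidean_space)
  qed
qed

lemma (in group) finite_generate_commuting:
  fixes p q :: nat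
  assumes a: "a \<in> carrier G" and b: "b \<in> carrier G" and ab: "a \<otimes> b = b \<otimes> a"
    and p: "a [^] p = \<one>" "p > 0" and q: "b [^] q = \<one>" "q > 0"
  shows "finite (generate G {a, b})"
proof -
  define S where "S = {a [^] (i::nat) \<otimes> b [^] (j::nat) | i j. True}"
  have pow_mod: "c [^] i = c [^] (i mod r)" if "c \<in> carrier G" "c [^] r = \<one>" for c and i r :: nat
  proof -
    have "c [^] i = c [^] (r * (i div r) + i mod r)" by simp
    also have "\<dots> = (c [^] r) [^] (i div r) \<otimes> c [^] (i mod r)"
      using that(1) by (simp only: nat_pow_mult nat_pow_pow nat_pow_closed)
    also have "(c [^] r) [^] (i div r) = \<one>" using that by (simp only: nat_pow_one)
    finally show ?thesis using that(1) by simp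
  qed
  have "S \<subseteq> (\<lambda>(i, j). a [^] i \<otimes> b [^] j) ` ({..<p} \<times> {..<q})"
  proof
    fix x assume "x \<in> S"
    then obtain i j :: nat where "x = a [^] i \<otimes> b [^] j" unfolding S_def by blast
    then have "x = a [^] (i mod p) \<otimes> b [^] (j mod q)"
      using pow_mod[OF a p(1), of i] pow_mod[OF b q(1), of j] by simp
    then show "x \<in> (\<lambda>(i, j). a [^] i \<otimes> b [^] j) ` ({..<p} \<times> {..<q})"
      using p q by (intro image_eqI[of _ _ "(i mod p, j mod q)"]) auto
  qed
  then have fin: "finite S" by (rule finite_subset) simp
  have powS: "a [^] i \<in> S" "b [^] i \<in> S" for i :: nat
  proof -
    have "a [^] i = a [^] i \<otimes> b [^] (0::nat)" "b [^] i = a [^] (0::nat) \<otimes> b [^] i"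
      using a b by simp_all
    then show "a [^] i \<in> S" "b [^] i \<in> S" unfolding S_def by blast+
  qed
  have inv_pow: "inv c = c [^] (r - 1)" if "c \<in> carrier G" "c [^] r = \<one>" "r > 0" for c and r :: nat
    using that by (intro inv_equality) (metis Suc_diff_1 nat_pow_Suc, auto)
  have comm: "b [^] i \<otimes> a [^] j = a [^] j \<otimes> b [^] i" for i j :: nat
    using a b ab by (metis nat_pow_closed pow_mult_distrib group_commutes_pow)
  have "generate G {a, b} \<subseteq> S"
  proof
    fix x assume "x \<in> generate G {a, b}"
    then show "x \<in> S"
    proof induction
      case one
      show ?case using powS(1)[of 0] by simp
    next
      case (incl h)
      then show ?case using powS[of 1] a b by auto
    next
      case (inv h)
      then show ?case using powS inv_pow a b p q by auto
    next
      case (eng g h)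
      then obtain i j k l :: nat where "g = a [^] i \<otimes> b [^] j" "h = a [^] k \<otimes> b [^] l"
        unfolding S_def by blast
      moreover have "a [^] i \<otimes> b [^] j \<otimes> (a [^] k \<otimes> b [^] l)
          = a [^] i \<otimes> (b [^] j \<otimes> a [^] k) \<otimes> b [^] l"
        using a b by (simp add: m_assoc)
      moreover have "\<dots> = (a [^] i \<otimes> a [^] k) \<otimes> (b [^] j \<otimes> b [^] l)"
        using a b by (simp add: m_assoc comm)
      ultimately have "g \<otimes> h = a [^] (i + k) \<otimes> b [^] (j + l)"
        using a b by (simp add: nat_pow_mult)
      then show ?case by (auto simp: S_def)
    qed
  qed
  then show ?thesis using fin by (rule finite_subset)
qed

lemma orthogonal_group_pow:
  "A \<in> carrier_mat m m \<Longrightarrow> A [^]\<^bsub>orthogonal_group m\<^esub> (k::nat) = A ^\<^sub>m k"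
  by (induction k) (auto simp: orthogonal_group_def nat_pow_def)

lemma rotation_mat_pow: "rotation_mat \<theta> ^\<^sub>m k = rotation_mat (real k * \<theta>)"
proof (induction k)
  case 0
  then show ?case using rotation_mat_carrier[of \<theta>] by (simp add: rotation_mat_0)
next
  case (Suc k)
  then show ?case by (simp add: rotation_mat_add algebra_simps)
qed

lemma rotation_mat_2pi: "rotation_mat (real k * (2 * pi)) = 1\<^sub>m 2"
proof -
  have "real k * (2 * pi) = 2 * real k * pi" by simp
  then have "cos (real k * (2 * pi)) = 1" "sin (real k * (2 * pi)) = 0"
    by (simp_all only: cos_2npi sin_2npi)
  then show ?thesis
    unfolding rotation_mat_0[symmetric] by (simp add: rotation_mat_def)
qed

lemma R_mat_pow:
  assumes "n > 0" shows "R_mat n ^\<^sub>m n = 1\<^sub>m (n - 1)"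
proof -
  define As where "As = map (\<lambda>k. rotation_mat (real k * (2 * pi / real n))) [1..<Suc ((n - 1) div 2)]
      @ (if even n then [- 1\<^sub>m 1] else [])"
  have d: "rotation_mat \<theta> \<in> carrier_mat 2 2" "dim_row (rotation_mat \<theta>) = 2"
    "dim_col (rotation_mat \<theta>) = 2" for \<theta>
    using rotation_mat_carrier[of \<theta>] by auto
  have R: "R_mat n = diag_block_mat As" by (simp add: R_mat_def As_def)
  have "A ^\<^sub>m n = 1\<^sub>m (dim_row A)" if "A \<in> set As" for A
  proof -
    have "A \<in> (\<lambda>k. rotation_mat (real k * (2 * pi / real n))) ` set [1..<Suc ((n - 1) div 2)]
        \<or> even n \<and> A = - 1\<^sub>m 1"
      using that unfolding As_def set_append set_map
      by (simp only: Un_iff split: if_splits) auto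
    then consider k where "A = rotation_mat (real k * (2 * pi / real n))" | "even n" "A = - 1\<^sub>m 1"
      by blast
    then show ?thesis
    proof cases
      case (1 k)
      have "real n * (real k * (2 * pi / real n)) = real k * (2 * pi)" using assms by simp
      then have "A ^\<^sub>m n = 1\<^sub>m 2" by (simp only: 1 rotation_mat_pow rotation_mat_2pi)
      then show ?thesis using 1 d by simp
    next
      case 2
      have "A ^\<^sub>m (2 * j) = 1\<^sub>m 1" for j
      proof (induction j)
        case (Suc j)
        have "(1\<^sub>m 1 :: real mat) * - 1\<^sub>m 1 * - 1\<^sub>m 1 = 1\<^sub>m 1"
          by (auto simp: scalar_prod_def intro!: eq_matI)
        with Suc show ?case by (simp add: 2)
      qed (simp add: 2)
      then show ?thesis using 2 by (auto elim!: evenE)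
    qed
  qed
  then have "map (\<lambda>A. A ^\<^sub>m n) As = map (\<lambda>A. 1\<^sub>m (dim_row A)) As" by simp
  moreover have "Ball (set As) square_mat"
    using d by (auto simp: As_def split: if_splits)
  ultimately have "R_mat n ^\<^sub>m n = 1\<^sub>m (sum_list (map dim_row As))"
    by (simp only: R diag_block_pow_mat diag_block_one_mat)
  moreover have "sum_list (map dim_row As) = n - 1"
    using R_mat_orthogonal[OF assms] unfolding orthogonal_group_carrier R
    by (metis carrier_matD(1) dim_diag_block_mat(1))
  ultimately show ?thesis by simp
qed

lemma finite_R_nu_group:
  assumes "n > 0" shows "finite (carrier (R_nu_group n))"
proof -
  interpret group "orthogonal_group (n - 1)" by (rule group_orthogonal_group)
  let ?G = "orthogonal_group (n - 1)"
  have R: "R_mat n \<in> carrier ?G" "R_mat n \<in> carrier_mat (n - 1) (n - 1)"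
    using R_mat_orthogonal[OF assms] by (auto simp: orthogonal_group_carrier)
  have N: "nu_mat n \<in> carrier ?G" "nu_mat n \<in> carrier_mat (n - 1) (n - 1)"
    using nu_mat_orthogonal[of n] by (auto simp: orthogonal_group_carrier)
  have "R_mat n \<otimes>\<^bsub>?G\<^esub> nu_mat n = nu_mat n \<otimes>\<^bsub>?G\<^esub> R_mat n"
    using R(2) by (simp add: orthogonal_group_def nu_mat_def)
  moreover have "R_mat n [^]\<^bsub>?G\<^esub> n = \<one>\<^bsub>?G\<^esub>"
    using R_mat_pow[OF assms] R by (simp add: orthogonal_group_pow) (simp add: orthogonal_group_def)
  moreover have "nu_mat n [^]\<^bsub>?G\<^esub> (2::nat) = \<one>\<^bsub>?G\<^esub>"
    using N by (simp add: orthogonal_group_pow numeral_2_eq_2)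
      (simp add: orthogonal_group_def nu_mat_def)
  ultimately have "finite (generate ?G {R_mat n, nu_mat n})"
    using R(1) N(1) assms by (intro finite_generate_commuting[where p = n and q = 2]) auto
  then show ?thesis
    using R(1) N(1) by (simp add: R_nu_group_def carrier_subgroup_generated)
qed

end

theory Submission
  imports Defs
begin

text \<open>
  A labelled \<open>n\<close>-segment is similar to a real \<open>n\<close>-tuple, which is unique up to real affine maps.
  The discrete Fourier transform identifies real \<open>n\<close>-tuples modulo constants with \<open>\<real>\<^sup>n\<^sup>-\<^sup>1\<close>
  (the coefficients \<open>k\<close> and \<open>n - k\<close> are conjugate), and turns the cyclic relabelling into \<^const>\<open>R_mat\<close>;
  the remaining real scalars are used up by normalizing to the unit sphere, except for the sign, which
  is \<^const>\<open>nu_mat\<close>. So the sphere maps onto the space of shapes of labelled segments, and after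
  division by \<^const>\<open>mu\<close> the fibres are exactly the orbits of \<^const>\<open>R_nu_group\<close>. The map is a
  quotient map because it has local sections: where \<open>z i \<noteq> z j\<close>, the tuple
  \<open>(z k - z j) / (z i - z j)\<close> is real and depends continuously on \<open>z\<close>.
\<close>

section \<open>The discrete Fourier transform\<close>

text \<open>The character of index \<open>k\<close> of the cyclic group of order \<open>n\<close>.
  Written as a power of one root of unity, its laws in \<open>j\<close> are laws of powers, valid
  also beyond \<open>n\<close>.\<close>

definition dft_char :: "nat \<Rightarrow> nat \<Rightarrow> nat \<Rightarrow> complex" where
  "dft_char n k j = cis (2 * pi * real k / real n) ^ j"

text \<open>The factor \<open>1 / n\<close> sits here, so that synthesis needs none; coefficient 0
  is then the mean of \<open>w\<close>.\<close>

definition dft :: "nat \<Rightarrow> (nat \<Rightarrow> complex) \<Rightarrow> nat \<Rightarrow> complex" where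
  "dft n w k = (\<Sum>j<n. w j * cnj (dft_char n k j)) / of_nat n"

lemma dft_char_0 [simp]: "dft_char n 0 j = 1"
  by (simp add: dft_char_def)

lemma dft_char_eq_cis: "dft_char n k j = cis (2 * pi * real k * real j / real n)"
  unfolding dft_char_def by (subst Complex.DeMoivre) (simp add: mult_ac)

lemma dft_char_pow_order: "n > 0 \<Longrightarrow> dft_char n k n = 1"
proof -
  assume "n > 0"
  then have "dft_char n k n = cis (2 * pi * real k)"
    by (simp add: dft_char_eq_cis)
  also have "\<dots> = 1"
    using cis_multiple_2pi[of "real k"] by simp
  finally show ?thesis .
qed

text \<open>The wrap-around costs nothing because the character has value 1 at \<open>n\<close>.
  This yields the factors by which a cyclic shift acts on Fourier coefficients.\<close>

lemma dft_char_Suc_mod: "n > 0 \<Longrightarrow> dft_char n k (Suc j mod n) = dft_char n k 1 * dft_char n k j"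
proof -
  assume n: "n > 0"
  have "dft_char n k (Suc j) = dft_char n k (n * (Suc j div n) + Suc j mod n)" by simp
  also have "\<dots> = (dft_char n k n) ^ (Suc j div n) * dft_char n k (Suc j mod n)"
    unfolding dft_char_def power_add power_mult ..
  finally show ?thesis using dft_char_pow_order[OF n] by (simp add: dft_char_def)
qed

text \<open>The two angles add up to a full turn. This pairs the coefficients \<open>k\<close> and
  \<open>n - k\<close> of a real tuple.\<close>

lemma dft_char_reflect:
  assumes "k \<le> n" "n > 0"
  shows "dft_char n (n - k) j = cnj (dft_char n k j)"
proof -
  have "cis (2 * pi * real (n - k) / real n) = cis (2 * pi + - (2 * pi * real k / real n))"
    using assms by (intro arg_cong[of _ _ cis]) (simp add: of_nat_diff field_simps)
  also have "\<dots> = cis (- (2 * pi * real k / real n))"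
    by (simp only: cis_mult[symmetric]) simp
  finally show ?thesis by (simp add: dft_char_def cis_cnj)
qed

text \<open>The terms are the powers of \<open>z\<close>, an \<open>n\<close>-th root of unity, so
  the geometric sum vanishes unless \<open>z = 1\<close>; that forces \<open>k = l\<close> because
  the \<open>n\<close> roots are distinct.\<close>

lemma sum_dft_char_orthogonal:
  assumes "k < n" "l < n"
  shows "(\<Sum>j<n. dft_char n k j * cnj (dft_char n l j)) = (if k = l then of_nat n else 0)"
proof -
  define z where "z = cis (2 * pi * real k / real n) * cnj (cis (2 * pi * real l / real n))"
  have n: "n > 0" using assms by simp
  have unit: "cis t * cnj (cis t) = 1" for t by (simp add: cis_cnj cis_mult)
  have eq: "dft_char n k j * cnj (dft_char n l j) = z ^ j" for j
    by (simp add: dft_char_def z_def power_mult_distrib)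
  have zn: "z ^ n = 1"
    using dft_char_pow_order[OF n, of k] dft_char_pow_order[OF n, of l] eq[of n] by simp
  show ?thesis
  proof (cases "k = l")
    case True
    then have "z = 1" by (simp add: z_def unit del: cis_cnj)
    with True show ?thesis unfolding eq by simp
  next
    case False
    have "z \<noteq> 1"
    proof
      assume "z = 1"
      then have "cis (2 * pi * real l / real n) * z = cis (2 * pi * real l / real n)" by simp
      moreover have "cis (2 * pi * real l / real n) * z = cis (2 * pi * real k / real n)"
        using unit[of "2 * pi * real l / real n"] by (simp add: z_def mult_ac)
      ultimately have "cis (2 * pi * real k / real n) = cis (2 * pi * real l / real n)" by simp
      then have "k = l"
        using bij_betw_imp_inj_on[OF Complex.bij_betw_roots_unity[OF n]] assms by (auto simp: inj_on_def)
      with False show False ..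
    qed
    then have "(\<Sum>j<n. z ^ j) = 0" using zn by (simp add: geometric_sum)
    then show ?thesis using False by (simp add: eq)
  qed
qed

lemma dft_synthesis:
  assumes "k < n"
  shows "dft n (\<lambda>j. \<Sum>l<n. c l * dft_char n l j) k = c k"
proof -
  have "(\<Sum>j<n. (\<Sum>l<n. c l * dft_char n l j) * cnj (dft_char n k j)) =
      (\<Sum>l<n. c l * (\<Sum>j<n. dft_char n l j * cnj (dft_char n k j)))"
    by (simp only: sum_distrib_left sum_distrib_right mult.assoc) (rule sum.swap)
  also have "\<dots> = (\<Sum>l<n. if k = l then c l * of_nat n else 0)"
    using assms by (intro sum.cong) (auto simp: sum_dft_char_orthogonal)
  also have "\<dots> = c k * of_nat n"
    using assms by simp
  finally show ?thesis using assms by (simp add: dft_def)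
qed

text \<open>\<open>dft_char n k j\<close> is symmetric in \<open>k\<close> and \<open>j\<close>, so
  orthogonality with the two roles exchanged gives inversion in this order as well.\<close>

lemma dft_inversion:
  assumes "j < n"
  shows "(\<Sum>k<n. dft n w k * dft_char n k j) = w j"
proof -
  have "(\<Sum>m<n. w m * cnj (dft_char n k m)) * dft_char n k j =
      (\<Sum>m<n. w m * (dft_char n j k * cnj (dft_char n m k)))" for k
    unfolding sum_distrib_right by (intro sum.cong) (simp_all add: dft_char_eq_cis mult_ac)
  then have "(\<Sum>k<n. (\<Sum>m<n. w m * cnj (dft_char n k m)) * dft_char n k j) =
      (\<Sum>m<n. w m * (\<Sum>k<n. dft_char n j k * cnj (dft_char n m k)))"
    by (simp only: sum_distrib_left) (rule sum.swap)
  also have "\<dots> = (\<Sum>m<n. if j = m then w m * of_nat n else 0)"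
    using assms by (intro sum.cong) (auto simp: sum_dft_char_orthogonal)
  also have "\<dots> = w j * of_nat n"
    using assms by simp
  finally show ?thesis using assms
    by (simp add: dft_def sum_divide_distrib[symmetric])
qed

text \<open>A translation adds a multiple of the character of index 0, which is orthogonal to those
  with \<open>0 < k < n\<close>; only the scalar survives.\<close>

lemma dft_affine:
  assumes "0 < k" "k < n" "\<And>j. j < n \<Longrightarrow> v j = a * w j + b"
  shows "dft n v k = a * dft n w k"
proof -
  have "(\<Sum>j<n. cnj (dft_char n k j)) = (\<Sum>j<n. dft_char n 0 j * cnj (dft_char n k j))" by simp
  also have "\<dots> = 0" using assms by (subst sum_dft_char_orthogonal) auto
  finally have 0: "(\<Sum>j<n. cnj (dft_char n k j)) = 0" .
  have "(\<Sum>j<n. v j * cnj (dft_char n k j)) =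
      a * (\<Sum>j<n. w j * cnj (dft_char n k j)) + b * (\<Sum>j<n. cnj (dft_char n k j))"
    using assms(3) by (simp add: sum_distrib_left sum.distrib[symmetric] algebra_simps)
  then show ?thesis by (simp add: dft_def 0)
qed

lemma dft_reflect:
  assumes "k \<le> n" "n > 0" "\<And>j. j < n \<Longrightarrow> w j \<in> \<real>"
  shows "dft n w (n - k) = cnj (dft n w k)"
  using assms Reals_cnj_iff by (simp add: dft_def dft_char_reflect)

section \<open>Real polygons in Fourier coordinates\<close>

text \<open>For \<open>0 < k < n\<close> this is the \<open>k\<close>-th Fourier coefficient of the real polygon with
  coordinates \<open>x\<close>: the \<open>k\<close>-th block of \<^term>\<open>R_mat n\<close> acts on the coordinates
  \<open>2 * k - 2\<close> and \<open>2 * k - 1\<close>. If \<open>n\<close> is even and \<open>k = n div 2\<close>, the second of them is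
  \<open>x (n - 1) = 0\<close>, since \<open>x\<close> vanishes from index \<open>n - 1\<close> on.\<close>

definition fourier_coeff :: "nat \<Rightarrow> (nat \<Rightarrow> real) \<Rightarrow> nat \<Rightarrow> complex" where
  "fourier_coeff n x k =
     (if 2 * k \<le> n then Complex (x (2 * k - 2)) (x (2 * k - 1))
      else Complex (x (2 * (n - k) - 2)) (- x (2 * (n - k) - 1)))"

text \<open>Synthesis without the term \<open>k = 0\<close>: the centroid is 0, which picks one
  representative modulo translation.\<close>

definition real_polygon :: "nat \<Rightarrow> (nat \<Rightarrow> real) \<Rightarrow> nat \<Rightarrow> complex" where
  "real_polygon n x = (\<lambda>j\<in>{..<n}. \<Sum>k=1..<n. fourier_coeff n x k * dft_char n k j)"

text \<open>Coefficients beyond \<open>n / 2\<close> are omitted, since conjugation recovers them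
  for real \<open>w\<close>. For even \<open>n\<close> the last coordinate, \<open>n - 2\<close>, is
  the real part of the middle coefficient.\<close>

definition fourier_coords :: "nat \<Rightarrow> (nat \<Rightarrow> complex) \<Rightarrow> nat \<Rightarrow> real" where
  "fourier_coords n w =
     (\<lambda>i. if i < n - 1 then
        (if even i then Re (dft n w (i div 2 + 1)) else Im (dft n w (i div 2 + 1))) else 0)"

lemma fourier_coeff_reflect:
  assumes "x \<in> topspace (Euclidean_space (n - 1))" "0 < k" "k < n"
  shows "fourier_coeff n x (n - k) = cnj (fourier_coeff n x k)"
proof -
  consider "2 * k < n" | "2 * k = n" | "2 * k > n" by linarith
  then show ?thesis
  proof cases
    case 2
    then have "n - k = k" by simp
    moreover have "x (2 * k - 1) = 0" using assms 2 by (simp add: topspace_Euclidean_space)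
    ultimately show ?thesis using 2 by (simp add: fourier_coeff_def complex_eq_iff)
  qed (use assms in \<open>auto simp: fourier_coeff_def complex_eq_iff\<close>)
qed

lemma fourier_coeff_scale: "fourier_coeff n (\<lambda>i. a * x i) k = of_real a * fourier_coeff n x k"
  by (simp add: fourier_coeff_def complex_eq_iff)

lemma real_polygon_eq:
  "j < n \<Longrightarrow> real_polygon n x j =
    (\<Sum>k<n. (if k = 0 then 0 else fourier_coeff n x k) * dft_char n k j)"
  unfolding real_polygon_def lessThan_atLeast0
  by (subst sum.atLeast_Suc_lessThan) (auto intro!: sum.cong)

lemma real_polygon_extensional: "real_polygon n x \<in> extensional {..<n}"
  by (simp add: real_polygon_def)

lemma real_polygon_scale: "j < n \<Longrightarrow> real_polygon n (\<lambda>i. a * x i) j = of_real a * real_polygon n x j"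
  by (simp add: real_polygon_def fourier_coeff_scale sum_distrib_left mult.assoc)

lemma dft_real_polygon:
  assumes "0 < k" "k < n"
  shows "dft n (real_polygon n x) k = fourier_coeff n x k"
proof -
  have "dft n (real_polygon n x) k =
      dft n (\<lambda>j. \<Sum>k<n. (if k = 0 then 0 else fourier_coeff n x k) * dft_char n k j) k"
    by (simp add: dft_def real_polygon_eq)
  then show ?thesis using assms dft_synthesis[OF assms(2)] by simp
qed

text \<open>Conjugation only permutes the terms of the sum, by exchanging \<open>k\<close> and
  \<open>n - k\<close>.\<close>

lemma real_polygon_real:
  assumes "x \<in> topspace (Euclidean_space (n - 1))" "j < n"
  shows "real_polygon n x j \<in> \<real>"
proof -
  have "cnj (\<Sum>k=1..<n. fourier_coeff n x k * dft_char n k j) =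
      (\<Sum>k=1..<n. fourier_coeff n x (n - k) * dft_char n (n - k) j)"
    using assms by (auto simp: fourier_coeff_reflect dft_char_reflect intro!: sum.cong)
  also have "\<dots> = (\<Sum>k=1..<n. fourier_coeff n x k * dft_char n k j)"
    by (rule sum.reindex_bij_witness[of _ "\<lambda>k. n - k" "\<lambda>k. n - k"]) auto
  finally show ?thesis using assms(2) by (simp add: real_polygon_def Reals_cnj_iff)
qed

lemma fourier_coords_Euclidean: "fourier_coords n w \<in> topspace (Euclidean_space (n - 1))"
  by (simp add: fourier_coords_def topspace_Euclidean_space)

text \<open>The factor has to be real: a complex one would mix real and imaginary parts, which are
  stored as separate coordinates.\<close>

lemma fourier_coords_affine:
  assumes "\<And>j. j < n \<Longrightarrow> v j = of_real a * w j + b"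
  shows "fourier_coords n v = (\<lambda>i. a * fourier_coords n w i)"
proof
  fix i
  have "dft n v (i div 2 + 1) = of_real a * dft n w (i div 2 + 1)" if "i < n - 1"
    using that assms by (intro dft_affine) auto
  then show "fourier_coords n v i = a * fourier_coords n w i"
    by (auto simp: fourier_coords_def)
qed

lemma fourier_coords_real_polygon:
  assumes "x \<in> topspace (Euclidean_space (n - 1))"
  shows "fourier_coords n (real_polygon n x) = x"
proof
  fix i
  show "fourier_coords n (real_polygon n x) i = x i"
  proof (cases "i < n - 1")
    case True
    then have k: "0 < i div 2 + 1" "i div 2 + 1 < n" "2 * (i div 2 + 1) \<le> n" by auto
    show ?thesis
    proof (cases "even i")
      case True
      then have "2 * (i div 2 + 1) - 2 = i" by simp
      then show ?thesis using True k \<open>i < n - 1\<close>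
        by (simp add: fourier_coords_def dft_real_polygon fourier_coeff_def)
    next
      case False
      then have "2 * (i div 2 + 1) - 1 = i" by presburger
      then show ?thesis using False k \<open>i < n - 1\<close>
        by (simp add: fourier_coords_def dft_real_polygon fourier_coeff_def)
    qed
  next
    case False
    then show ?thesis using assms by (simp add: fourier_coords_def topspace_Euclidean_space)
  qed
qed

text \<open>Up to the middle index the coefficients are read off directly. Beyond it both sides are
  the conjugates of their values at \<open>n - k\<close>, the right one because \<open>w\<close> is
  real.\<close>

lemma fourier_coeff_fourier_coords:
  assumes w: "\<And>j. j < n \<Longrightarrow> w j \<in> \<real>" and k: "0 < k" "k < n"
  shows "fourier_coeff n (fourier_coords n w) k = dft n w k"
proof -
  have le: "fourier_coeff n (fourier_coords n w) k = dft n w k"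
    if "0 < k" "2 * k \<le> n" for k
  proof -
    have 1: "(2 * k - 2) div 2 + 1 = k" "(2 * k - 1) div 2 + 1 = k" "odd (2 * k - 1)"
      using that by presburger+
    \<comment> \<open>The middle coefficient is its own conjugate, so forgetting its imaginary part
      loses nothing.\<close>
    have im: "Im (dft n w k) = 0" if "2 * k = n"
    proof -
      have "n - k = k" using that by simp
      then show ?thesis
        using dft_reflect[of k n w] w that \<open>0 < k\<close> by (simp add: complex_eq_iff)
    qed
    show ?thesis
    proof (cases "2 * k = n")
      case True
      with that have "2 * k - 2 < n - 1" "\<not> 2 * k - 1 < n - 1" by auto
      with True 1 im show ?thesis
        by (simp add: fourier_coeff_def fourier_coords_def complex_eq_iff)
    next
      case False
      with that have "2 * k - 2 < n - 1" "2 * k - 1 < n - 1" "2 * k \<le> n" by auto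
      with 1 show ?thesis
        by (simp add: fourier_coeff_def fourier_coords_def complex_eq_iff)
    qed
  qed
  show ?thesis
  proof (cases "2 * k \<le> n")
    case False
    have "fourier_coeff n (fourier_coords n w) (n - (n - k)) =
        cnj (fourier_coeff n (fourier_coords n w) (n - k))"
      using k by (intro fourier_coeff_reflect fourier_coords_Euclidean) auto
    also have "\<dots> = cnj (dft n w (n - k))" using False k by (subst le) auto
    also have "\<dots> = dft n w k" using dft_reflect[of k n w] w k by simp
    finally show ?thesis using k by simp
  qed (use le k in auto)
qed

text \<open>Inversion restores every coefficient except that of index 0, so exactly the mean is
  lost.\<close>

lemma real_polygon_fourier_coords:
  assumes w: "\<And>j. j < n \<Longrightarrow> w j \<in> \<real>" and j: "j < n"
  shows "real_polygon n (fourier_coords n w) j = w j - dft n w 0"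
proof -
  have "real_polygon n (fourier_coords n w) j = (\<Sum>k=1..<n. dft n w k * dft_char n k j)"
    using j w by (auto simp: real_polygon_def fourier_coeff_fourier_coords intro!: sum.cong)
  moreover have "w j = (\<Sum>k=0..<n. dft n w k * dft_char n k j)"
    using dft_inversion[OF j, of w] by (simp add: lessThan_atLeast0)
  then have "w j = dft n w 0 + (\<Sum>k=1..<n. dft n w k * dft_char n k j)"
    using j by (simp add: sum.atLeast_Suc_lessThan)
  ultimately show ?thesis by simp
qed

section \<open>Cyclic relabelling as the matrix \<^const>\<open>R_mat\<close>\<close>

lemma mat_act_diag_block_Cons:
  assumes "A \<in> carrier_mat m m" "square_mat (diag_block_mat As)"
  shows "mat_act (diag_block_mat (A # As)) x i =
    (if i < m then mat_act A x i else mat_act (diag_block_mat As) (\<lambda>j. x (m + j)) (i - m))"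
proof -
  define B where "B = diag_block_mat As"
  define l where "l = dim_row B"
  have A: "dim_row A = m" "dim_col A = m" and B: "dim_row B = l" "dim_col B = l"
    using assms by (auto simp: B_def l_def)
  have eq: "diag_block_mat (A # As) = four_block_mat A (0\<^sub>m m l) (0\<^sub>m l m) B"
    using A B by (simp add: B_def[symmetric] Let_def)
  have split: "(\<Sum>j<m + l. f j) = (\<Sum>j<m. f j) + (\<Sum>j<l. f (m + j))" for f :: "nat \<Rightarrow> real"
    by (induction l) (auto simp: algebra_simps)
  show ?thesis
    unfolding eq B_def[symmetric]
    by (auto simp: mat_act_def A B split index_mat_four_block)
qed

lemma mat_act_rotation_mat:
  "mat_act (rotation_mat t) x 0 = cos t * x 0 - sin t * x 1"
  "mat_act (rotation_mat t) x 1 = sin t * x 0 + cos t * x 1"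
proof -
  have "{..<2::nat} = {0, 1}" by auto
  then show "mat_act (rotation_mat t) x 0 = cos t * x 0 - sin t * x 1"
    "mat_act (rotation_mat t) x 1 = sin t * x 0 + cos t * x 1"
    using rotation_mat_carrier[of t] by (auto simp: mat_act_def rotation_mat_index
      rotation_mat_index[unfolded One_nat_def])
qed

text \<open>Squareness belongs to the induction because \<open>mat_act_diag_block_Cons\<close>
  demands it of the tail, and \<open>x\<close> is quantified since the tail sees shifted
  coordinates. The trailing \<open>Bs\<close> make room for the block -1 of even
  \<open>n\<close>.\<close>

lemma mat_act_rotation_blocks:
  assumes "square_mat (diag_block_mat Bs)"
  shows "square_mat (diag_block_mat (map rotation_mat ts @ Bs)) \<and>
    (\<forall>x. (\<forall>k<length ts.
        mat_act (diag_block_mat (map rotation_mat ts @ Bs)) x (2 * k) =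
          cos (ts ! k) * x (2 * k) - sin (ts ! k) * x (2 * k + 1) \<and>
        mat_act (diag_block_mat (map rotation_mat ts @ Bs)) x (2 * k + 1) =
          sin (ts ! k) * x (2 * k) + cos (ts ! k) * x (2 * k + 1)) \<and>
      (\<forall>i. mat_act (diag_block_mat (map rotation_mat ts @ Bs)) x (2 * length ts + i) =
          mat_act (diag_block_mat Bs) (\<lambda>j. x (2 * length ts + j)) i))"
proof (induction ts)
  case Nil
  then show ?case using assms by simp
next
  case (Cons t ts)
  let ?B = "diag_block_mat (map rotation_mat ts @ Bs)"
  have sq: "square_mat ?B" using Cons by blast
  have act: "mat_act (diag_block_mat (map rotation_mat (t # ts) @ Bs)) x i =
    (if i < 2 then mat_act (rotation_mat t) x i else mat_act ?B (\<lambda>j. x (2 + j)) (i - 2))" for x i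
    using mat_act_diag_block_Cons[OF rotation_mat_carrier sq] by simp
  have "square_mat (diag_block_mat (map rotation_mat (t # ts) @ Bs))"
    using sq rotation_mat_carrier[of t] by (simp add: Let_def)
  moreover have "mat_act (diag_block_mat (map rotation_mat (t # ts) @ Bs)) x (2 * k) =
          cos ((t # ts) ! k) * x (2 * k) - sin ((t # ts) ! k) * x (2 * k + 1) \<and>
        mat_act (diag_block_mat (map rotation_mat (t # ts) @ Bs)) x (2 * k + 1) =
          sin ((t # ts) ! k) * x (2 * k) + cos ((t # ts) ! k) * x (2 * k + 1)"
    if "k < length (t # ts)" for x k
  proof (cases k)
    case 0
    then show ?thesis unfolding act by (simp add: mat_act_rotation_mat[unfolded One_nat_def])
  next
    case (Suc k')
    then have "k' < length ts" using that by simp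
    with Cons.IH have "mat_act ?B (\<lambda>j. x (2 + j)) (2 * k') =
          cos (ts ! k') * x (2 + 2 * k') - sin (ts ! k') * x (2 + (2 * k' + 1)) \<and>
        mat_act ?B (\<lambda>j. x (2 + j)) (2 * k' + 1) =
          sin (ts ! k') * x (2 + 2 * k') + cos (ts ! k') * x (2 + (2 * k' + 1))"
      by blast
    then show ?thesis unfolding act using Suc by simp
  qed
  moreover have "mat_act (diag_block_mat (map rotation_mat (t # ts) @ Bs)) x (2 * length (t # ts) + i) =
          mat_act (diag_block_mat Bs) (\<lambda>j. x (2 * length (t # ts) + j)) i" for x i
  proof -
    have "mat_act ?B (\<lambda>j. x (2 + j)) (2 * length ts + i) =
        mat_act (diag_block_mat Bs) (\<lambda>j. x (2 + (2 * length ts + j))) i"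
      using Cons.IH by blast
    then show ?thesis unfolding act by (simp add: add.assoc[symmetric])
  qed
  ultimately show ?case by blast
qed

text \<open>Rotating a pair of coordinates multiplies the complex number that they form by a unit,
  here \<open>dft_char n k 1\<close>. Indices beyond the middle follow by conjugation.\<close>

lemma fourier_coeff_R_mat:
  assumes x: "x \<in> topspace (Euclidean_space (n - 1))" and k: "0 < k" "k < n"
  shows "fourier_coeff n (mat_act (R_mat n) x) k = dft_char n k 1 * fourier_coeff n x k"
proof -
  let ?y = "mat_act (R_mat n) x"
  define ts where "ts = map (\<lambda>k. real k * (2 * pi / real n)) [1..<Suc ((n - 1) div 2)]"
  define Bs :: "real mat list" where "Bs = (if even n then [- 1\<^sub>m 1] else [])"
  have dims: "dim_row (R_mat n) = n - 1"
    using R_mat_orthogonal[of n] k by (auto simp: orthogonal_group_carrier)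
  have yE: "?y \<in> topspace (Euclidean_space (n - 1))"
    by (simp add: topspace_Euclidean_space mat_act_def dims)
  have R: "R_mat n = diag_block_mat (map rotation_mat ts @ Bs)"
    by (simp add: R_mat_def ts_def Bs_def o_def del: upt_Suc)
  have len: "length ts = (n - 1) div 2" by (simp add: ts_def)
  have "square_mat (diag_block_mat Bs)" by (simp add: Bs_def)
  note blocks = mat_act_rotation_blocks[OF this, of ts, folded R]
  have le: "fourier_coeff n ?y k = dft_char n k 1 * fourier_coeff n x k"
    if k: "0 < k" "2 * k \<le> n" for k
  proof (cases "2 * k = n")
    case True
    then have n: "2 * length ts = 2 * k - 2" "n - 1 = 2 * k - 1" "even n"
      unfolding len by presburger+
    \<comment> \<open>The last coordinate, \<open>n - 2\<close>, meets the block -1, in agreement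
      with the value \<open>cis pi\<close> of the middle character.\<close>
    have "?y (2 * length ts + 0) = mat_act (diag_block_mat Bs) (\<lambda>j. x (2 * length ts + j)) 0"
      using blocks by blast
    then have "?y (2 * k - 2) = - x (2 * k - 2)"
      by (simp add: n Bs_def mat_act_def)
    moreover have "x (2 * k - 1) = 0" "?y (2 * k - 1) = 0"
      using x yE n(2) by (simp_all add: topspace_Euclidean_space)
    moreover have "dft_char n k 1 = - 1"
    proof -
      have "dft_char n k 1 = cis pi"
        using True k by (auto simp: dft_char_def intro!: arg_cong[of _ _ cis])
      then show ?thesis by simp
    qed
    ultimately show ?thesis using True by (simp add: fourier_coeff_def complex_eq_iff)
  next
    case False
    then have l: "k - 1 < length ts" using k by (auto simp: len)
    then have t: "ts ! (k - 1) = 2 * pi * real k / real n"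
      using k by (simp add: ts_def len del: upt_Suc)
    have idx: "2 * (k - 1) = 2 * k - 2" "2 * k - 2 + 1 = 2 * k - 1" using k by auto
    define t where "t = ts ! (k - 1)"
    have "?y (2 * (k - 1)) = cos t * x (2 * (k - 1)) - sin t * x (2 * (k - 1) + 1)"
      "?y (2 * (k - 1) + 1) = sin t * x (2 * (k - 1)) + cos t * x (2 * (k - 1) + 1)"
      using blocks l unfolding t_def by blast+
    then have "?y (2 * k - 2) = cos t * x (2 * k - 2) - sin t * x (2 * k - 1)"
      "?y (2 * k - 1) = sin t * x (2 * k - 2) + cos t * x (2 * k - 1)"
      by (simp_all only: idx)
    moreover have "dft_char n k 1 = cis t" by (simp only: dft_char_def t_def t power_one_right)
    ultimately show ?thesis using k by (simp add: fourier_coeff_def complex_eq_iff)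
  qed
  show ?thesis
  proof (cases "2 * k \<le> n")
    case False
    have "fourier_coeff n ?y (n - (n - k)) = cnj (fourier_coeff n ?y (n - k))"
      using k by (intro fourier_coeff_reflect yE) auto
    also have "\<dots> = cnj (dft_char n (n - k) 1 * fourier_coeff n x (n - k))"
      using False k by (subst le) auto
    also have "\<dots> = dft_char n k 1 * fourier_coeff n x k"
      using x k by (simp add: dft_char_reflect fourier_coeff_reflect)
    finally show ?thesis using k by simp
  qed (use le k in auto)
qed

text \<open>Term by term, the shift produces by \<open>dft_char_Suc_mod\<close> the same factor that
  the matrix produces by \<open>fourier_coeff_R_mat\<close>.\<close>

lemma real_polygon_R_mat:
  assumes "x \<in> topspace (Euclidean_space (n - 1))"
  shows "real_polygon n (mat_act (R_mat n) x) = cyc n (real_polygon n x)"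
proof
  fix j
  show "real_polygon n (mat_act (R_mat n) x) j = cyc n (real_polygon n x) j"
  proof (cases "j < n")
    case True
    then show ?thesis using assms
      by (auto simp: real_polygon_def cyc_def fourier_coeff_R_mat dft_char_Suc_mod mult_ac
          intro!: sum.cong)
  qed (simp add: real_polygon_def cyc_def)
qed

section \<open>Orbits\<close>

text \<open>The action laws are asked only on an invariant set \<open>S\<close>: affine maps,
  elements of \<open>mu_group\<close> and matrices act properly only on extensional tuples, shapes
  and sequences of bounded support, respectively.\<close>

lemma orbit_eq_iff:
  fixes G (structure)
  assumes "group G"
    and closed: "\<And>g x. g \<in> carrier G \<Longrightarrow> x \<in> S \<Longrightarrow> \<phi> g x \<in> S"
    and one: "\<And>x. x \<in> S \<Longrightarrow> \<phi> \<one> x = x"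
    and mult: "\<And>g h x. g \<in> carrier G \<Longrightarrow> h \<in> carrier G \<Longrightarrow> x \<in> S \<Longrightarrow>
      \<phi> (g \<otimes> h) x = \<phi> g (\<phi> h x)"
    and x: "x \<in> S" and y: "y \<in> S"
  shows "orbit G \<phi> x = orbit G \<phi> y \<longleftrightarrow> (\<exists>g\<in>carrier G. y = \<phi> g x)"
proof
  interpret group G by fact
  assume "orbit G \<phi> x = orbit G \<phi> y"
  moreover have "y \<in> orbit G \<phi> y"
    using one[OF y] one_closed unfolding orbit_def by force
  ultimately show "\<exists>g\<in>carrier G. y = \<phi> g x" by (auto simp: orbit_def)
next
  interpret group G by fact
  have sub: "orbit G \<phi> v \<subseteq> orbit G \<phi> u" if "u \<in> S" "g \<in> carrier G" "v = \<phi> g u" for u v g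
  proof
    fix w assume "w \<in> orbit G \<phi> v"
    then obtain h where "h \<in> carrier G" "w = \<phi> h v" by (auto simp: orbit_def)
    with that have "w = \<phi> (h \<otimes> g) u" "h \<otimes> g \<in> carrier G" by (simp_all add: mult)
    then show "w \<in> orbit G \<phi> u" by (auto simp: orbit_def)
  qed
  assume "\<exists>g\<in>carrier G. y = \<phi> g x"
  then obtain g where g: "g \<in> carrier G" "y = \<phi> g x" by blast
  then have "\<phi> (inv g) y = \<phi> (inv g \<otimes> g) x" using x mult[of "inv g" g x] by simp
  also have "\<dots> = x" using g x by (simp add: one)
  finally have "x = \<phi> (inv g) y" ..
  then show "orbit G \<phi> x = orbit G \<phi> y"
    using sub[OF x g] sub[OF y inv_closed[OF g(1)]] by blast
qed

lemma eta_eq_iff: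
  assumes "z \<in> topspace (polygons n)" "w \<in> topspace (polygons n)"
  shows "eta n z = eta n w \<longleftrightarrow> (\<exists>a b. a \<noteq> 0 \<and> (\<forall>j<n. w j = a * z j + b))"
proof -
  have "eta n z = eta n w \<longleftrightarrow> (\<exists>g\<in>carrier affine_group. w = affine_act n g z)"
    unfolding eta_def
  proof (rule orbit_eq_iff[where S = "topspace (polygons n)"])
    fix g u assume "g \<in> carrier affine_group" "u \<in> topspace (polygons n)"
    then have "affine_act n g u \<in> eta n u" by (auto simp: eta_def orbit_def)
    then show "affine_act n g u \<in> topspace (polygons n)"
      using eta_subset \<open>u \<in> topspace (polygons n)\<close> by blast
  next
    fix u assume "u \<in> topspace (polygons n)"
    then show "affine_act n \<one>\<^bsub>affine_group\<^esub> u = u"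
      by (auto simp: affine_act_def affine_group_one topspace_polygons fun_eq_iff extensional_def)
  qed (use assms in \<open>auto simp: group_affine_group affine_act_def affine_group_mult\<close>)
  also have "\<dots> \<longleftrightarrow> (\<exists>a b. a \<noteq> 0 \<and> w = (\<lambda>j\<in>{..<n}. a * z j + b))"
    unfolding Bex_def affine_group_carrier affine_act_def by blast
  also have "\<dots> \<longleftrightarrow> (\<exists>a b. a \<noteq> 0 \<and> (\<forall>j<n. w j = a * z j + b))"
    using assms by (auto simp: topspace_polygons fun_eq_iff extensional_def)
  finally show ?thesis .
qed

section \<open>The group generated by \<open>mu\<close> acting on shapes\<close>

lemma group_mu_group: "group (mu_group n)"
  unfolding mu_group_def by (intro group.group_subgroup_generated group_BijGroup)

lemma carrier_mu_group:
  assumes "n > 0"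
  shows "carrier (mu_group n) = generate (BijGroup (topspace (P_space n))) {mu n}"
  using mu_in_Bij[OF assms] group_BijGroup
  by (simp add: mu_group_def carrier_subgroup_generated)

lemma mu_group_subset: "carrier (mu_group n) \<subseteq> Bij (topspace (P_space n))"
  using group.carrier_subgroup_generated_subset[OF group_BijGroup, of "topspace (P_space n)"]
  by (simp add: mu_group_def BijGroup_def)

lemma orbit_mu_group_eq_iff:
  assumes n: "n > 0" and p: "p \<in> topspace (P_space n)" "q \<in> topspace (P_space n)"
  shows "orbit (mu_group n) (\<lambda>g. g) p = orbit (mu_group n) (\<lambda>g. g) q \<longleftrightarrow>
    (\<exists>g\<in>carrier (mu_group n). q = g p)"
proof (rule orbit_eq_iff[where S = "topspace (P_space n)"])
  show "\<one>\<^bsub>mu_group n\<^esub> x = x" if "x \<in> topspace (P_space n)" for x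
    using that by (simp add: mu_group_def BijGroup_def)
next
  fix g h x
  assume g: "g \<in> carrier (mu_group n)" and x: "x \<in> topspace (P_space n)"
  then have gB: "g \<in> Bij (topspace (P_space n))" using mu_group_subset by blast
  then show "g x \<in> topspace (P_space n)" using x Bij_imp_funcset by blast
  assume "h \<in> carrier (mu_group n)"
  then have "h \<in> Bij (topspace (P_space n))" using mu_group_subset by blast
  with gB x show "(g \<otimes>\<^bsub>mu_group n\<^esub> h) x = g (h x)"
    by (simp add: mu_group_def BijGroup_def compose_def)
qed (use p in \<open>auto simp: group_mu_group\<close>)

section \<open>Orthogonal matrices acting on the sphere\<close>

lemma mat_act_eq_mult_mat_vec:
  assumes "A \<in> carrier_mat m m" "i < m"
  shows "mat_act A x i = vec_index (A *\<^sub>v vec m x) i"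
proof -
  have "vec_index (A *\<^sub>v vec m x) i = (\<Sum>j\<in>{0..<m}. A $$ (i, j) * x j)"
    using assms by (auto simp: scalar_prod_def intro!: sum.cong)
  then show ?thesis using assms by (simp add: mat_act_def lessThan_atLeast0)
qed

lemma vec_mat_act:
  assumes "A \<in> carrier_mat m m"
  shows "vec m (mat_act A x) = A *\<^sub>v vec m x"
  using assms by (intro eq_vecI) (simp_all add: mat_act_eq_mult_mat_vec)

lemma mat_act_zero: "A \<in> carrier_mat m m \<Longrightarrow> \<not> i < m \<Longrightarrow> mat_act A x i = 0"
  by (simp add: mat_act_def)

lemma mat_act_mult:
  assumes "A \<in> carrier_mat m m" "B \<in> carrier_mat m m"
  shows "mat_act (A * B) x = mat_act A (mat_act B x)"
proof
  fix i
  show "mat_act (A * B) x i = mat_act A (mat_act B x) i"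
  proof (cases "i < m")
    case True
    then show ?thesis using assms
      by (simp add: mat_act_eq_mult_mat_vec[of _ m] vec_mat_act assoc_mult_mat_vec[of _ m m _ m])
  next
    case False
    then show ?thesis using assms by (simp add: mat_act_zero[of _ m])
  qed
qed

lemma mat_act_one:
  assumes "x \<in> topspace (Euclidean_space m)"
  shows "mat_act (1\<^sub>m m) x = x"
proof
  fix i
  show "mat_act (1\<^sub>m m) x i = x i"
    using assms
    by (cases "i < m") (simp_all add: mat_act_eq_mult_mat_vec[of _ m] mat_act_zero[of _ m]
        topspace_Euclidean_space)
qed

lemma topspace_nsphere_Suc:
  "topspace (nsphere m) =
    {x \<in> topspace (Euclidean_space (Suc m)). scalar_prod (vec (Suc m) x) (vec (Suc m) x) = 1}"
  by (auto simp: nsphere_def scalar_prod_def lessThan_Suc_atMost[symmetric] lessThan_atLeast0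
      power2_eq_square)

text \<open>Moving \<open>A\<close> across the scalar product as its transpose leaves
  \<open>transpose_mat A * A\<close>, which is the identity.\<close>

lemma mat_act_nsphere:
  assumes A: "A \<in> carrier (orthogonal_group (Suc m))" and x: "x \<in> topspace (nsphere m)"
  shows "mat_act A x \<in> topspace (nsphere m)"
proof -
  let ?v = "vec (Suc m) x"
  have c: "A \<in> carrier_mat (Suc m) (Suc m)" "transpose_mat A * A = 1\<^sub>m (Suc m)"
    using A by (auto simp: orthogonal_group_carrier)
  have v: "?v \<in> carrier_vec (Suc m)" by simp
  have "scalar_prod (A *\<^sub>v ?v) (A *\<^sub>v ?v) = scalar_prod ?v (transpose_mat A *\<^sub>v (A *\<^sub>v ?v))"
    using transpose_vec_mult_scalar[OF c(1) v mult_mat_vec_carrier[OF c(1) v]] c(1) v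
    by (simp add: comm_scalar_prod[of ?v "Suc m"])
  also have "transpose_mat A *\<^sub>v (A *\<^sub>v ?v) = ?v"
    using c v assoc_mult_mat_vec[of "transpose_mat A" "Suc m" "Suc m" A "Suc m" ?v] by simp
  finally show ?thesis
    using x c(1) by (simp add: topspace_nsphere_Suc vec_mat_act topspace_Euclidean_space mat_act_zero)
qed

lemma carrier_R_nu_group:
  assumes "n > 0"
  shows "carrier (R_nu_group n) = generate (orthogonal_group (n - 1)) {R_mat n, nu_mat n}"
  using R_mat_orthogonal[OF assms] nu_mat_orthogonal[of n] group_orthogonal_group
  by (simp add: R_nu_group_def carrier_subgroup_generated)

lemma R_nu_group_orthogonal: "carrier (R_nu_group n) \<subseteq> carrier (orthogonal_group (n - 1))"
  unfolding R_nu_group_def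
  by (rule group.carrier_subgroup_generated_subset[OF group_orthogonal_group])

lemma group_R_nu_group: "group (R_nu_group n)"
  unfolding R_nu_group_def by (intro group.group_subgroup_generated group_orthogonal_group)

lemma orbit_R_nu_group_eq_iff:
  assumes n: "n \<ge> 2" and x: "x \<in> topspace (nsphere (n - 2))" "y \<in> topspace (nsphere (n - 2))"
  shows "orbit (R_nu_group n) mat_act x = orbit (R_nu_group n) mat_act y \<longleftrightarrow>
    (\<exists>g\<in>carrier (R_nu_group n). y = mat_act g x)"
proof (rule orbit_eq_iff[where S = "topspace (nsphere (n - 2))"])
  \<comment> \<open>\<open>nsphere m\<close> lies in dimension \<open>Suc m\<close>, so
    \<open>n - 2\<close> for the sphere matches \<open>n - 1\<close> for the matrices;
    \<open>n\<close> is at least 2, so subtraction is not truncated.\<close>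
  have s: "Suc (n - 2) = n - 1" using n by simp
  fix g h x
  assume x: "x \<in> topspace (nsphere (n - 2))"
  show "mat_act \<one>\<^bsub>R_nu_group n\<^esub> x = x"
    using x mat_act_one[of x "n - 1"]
    by (simp add: R_nu_group_def orthogonal_group_def topspace_nsphere_Suc s)
  assume g: "g \<in> carrier (R_nu_group n)"
  then have go: "g \<in> carrier (orthogonal_group (n - 1))" using R_nu_group_orthogonal by blast
  then show "mat_act g x \<in> topspace (nsphere (n - 2))" using x by (simp add: mat_act_nsphere s)
  assume "h \<in> carrier (R_nu_group n)"
  then have "h \<in> carrier (orthogonal_group (n - 1))" using R_nu_group_orthogonal by blast
  with go show "mat_act (g \<otimes>\<^bsub>R_nu_group n\<^esub> h) x = mat_act g (mat_act h x)"
    by (simp add: R_nu_group_def orthogonal_group_def mat_act_mult[of _ "n - 1"])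
qed (use x in \<open>auto simp: group_R_nu_group\<close>)

section \<open>Local sections over the shapes of segments\<close>

text \<open>Radial projection. The index \<open>m\<close> is the dimension of the sphere, so the
  coordinates run up to \<open>m\<close> inclusive.\<close>

definition normalized :: "nat \<Rightarrow> (nat \<Rightarrow> real) \<Rightarrow> nat \<Rightarrow> real" where
  "normalized m x = (\<lambda>i. x i / sqrt (\<Sum>i\<le>m. x i ^ 2))"

text \<open>Before projecting, vertex \<open>j\<close> is moved to 0 and vertex \<open>i\<close> to
  1, which makes all vertices of a segment real.\<close>

definition sphere_section :: "nat \<Rightarrow> nat \<Rightarrow> nat \<Rightarrow> (nat \<Rightarrow> complex) \<Rightarrow> nat \<Rightarrow> real" where
  "sphere_section n i j z =
     normalized (n - 2) (fourier_coords n (\<lambda>k. (z k - z j) / (z i - z j)))"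

lemma topspace_nsphere_eq:
  "n \<ge> 2 \<Longrightarrow> topspace (nsphere (n - 2)) =
    {x \<in> topspace (Euclidean_space (n - 1)). (\<Sum>i\<le>n - 2. x i ^ 2) = 1}"
  by (auto simp: nsphere_def Suc_diff_Suc numeral_2_eq_2)

lemma sum_squares_pos:
  assumes "n \<ge> 2" "x \<in> topspace (Euclidean_space (n - 1))" "x \<noteq> (\<lambda>_. 0)"
  shows "(\<Sum>i\<le>n - 2. x i ^ 2) > (0 :: real)"
proof -
  obtain i where i: "x i \<noteq> 0" using assms(3) by auto
  then have "\<not> n - 1 \<le> i" using assms(2) by (auto simp: topspace_Euclidean_space)
  then have "i \<le> n - 2" by simp
  then show ?thesis using i by (intro sum_pos2[of _ i]) auto
qed

lemma normalized_nsphere: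
  assumes "n \<ge> 2" "x \<in> topspace (Euclidean_space (n - 1))" "x \<noteq> (\<lambda>_. 0)"
  shows "normalized (n - 2) x \<in> topspace (nsphere (n - 2))"
proof -
  have pos: "(\<Sum>i\<le>n - 2. x i ^ 2) > (0 :: real)" by (rule sum_squares_pos[OF assms])
  then have "(\<Sum>i\<le>n - 2. (x i / sqrt (\<Sum>i\<le>n - 2. x i ^ 2)) ^ 2) = 1"
    by (simp add: power_divide sum_divide_distrib[symmetric])
  then show ?thesis using assms
    by (simp add: topspace_nsphere_eq normalized_def topspace_Euclidean_space)
qed

section \<open>Collinearity by real equations\<close>

lemma Reals_divide_cnj:
  fixes a b :: complex
  assumes "Im (a * cnj b) = 0"
  shows "a / b \<in> \<real>"
proof -
  \<comment> \<open>The denominator is a squared norm, hence real; \<open>b = 0\<close> is covered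
    because division by zero yields 0.\<close>
  have "a / b = of_real (Re (a * cnj b)) / of_real ((norm b)\<^sup>2)"
    using assms unfolding complex_div_cnj[of a b] by (simp add: complex_eq_iff)
  then show ?thesis by simp
qed

text \<open>Free of division, these equations also cover coinciding vertices, and they present the
  segments as a zero set of continuous functions.\<close>

lemma segments_iff:
  assumes "z \<in> topspace (polygons n)"
  shows "z \<in> segments n \<longleftrightarrow>
    (\<forall>i<n. \<forall>j<n. \<forall>k<n. Im ((z k - z j) * cnj (z i - z j)) = 0)"
proof
  assume "z \<in> segments n"
  then obtain u where u: "\<And>x y. x \<in> z ` {..<n} \<Longrightarrow> y \<in> z ` {..<n} \<Longrightarrow> \<exists>c. x - y = c *\<^sub>R u"
    unfolding segments_def collinear_def by blast
  show "\<forall>i<n. \<forall>j<n. \<forall>k<n. Im ((z k - z j) * cnj (z i - z j)) = 0"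
  proof (intro allI impI)
    fix i j k assume "i < n" "j < n" "k < n"
    then obtain c d where "z k - z j = c *\<^sub>R u" "z i - z j = d *\<^sub>R u"
      using u[of "z k" "z j"] u[of "z i" "z j"] by auto
    then show "Im ((z k - z j) * cnj (z i - z j)) = 0" by simp
  qed
next
  assume *: "\<forall>i<n. \<forall>j<n. \<forall>k<n. Im ((z k - z j) * cnj (z i - z j)) = 0"
  have "collinear (z ` {..<n})"
  proof (cases "\<exists>i<n. \<exists>j<n. z i \<noteq> z j")
    case True
    then obtain i j where ij: "i < n" "j < n" "z i \<noteq> z j" by blast
    \<comment> \<open>Two distinct vertices span the line.\<close>
    define u where "u = z i - z j"
    have mult: "z k - z j = Re ((z k - z j) / u) *\<^sub>R u" if "k < n" for k
    proof -
      have "(z k - z j) / u \<in> \<real>"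
        using * ij that unfolding u_def by (intro Reals_divide_cnj) blast
      then have "of_real (Re ((z k - z j) / u)) * u = (z k - z j) / u * u" by simp
      then show ?thesis using ij by (simp add: scaleR_conv_of_real u_def)
    qed
    show ?thesis unfolding collinear_def
    proof (rule exI[of _ u], intro ballI)
      fix x y assume "x \<in> z ` {..<n}" "y \<in> z ` {..<n}"
      then obtain k l where kl: "x = z k" "y = z l" "k < n" "l < n" by auto
      have "x - y = (z k - z j) - (z l - z j)" by (simp add: kl)
      also have "\<dots> = (Re ((z k - z j) / u) - Re ((z l - z j) / u)) *\<^sub>R u"
        using mult[OF kl(3)] mult[OF kl(4)] by (simp only: scaleR_left_diff_distrib)
      finally show "\<exists>c. x - y = c *\<^sub>R u" by blast
    qed
  next
    case False
    then have "x = y" if "x \<in> z ` {..<n}" "y \<in> z ` {..<n}" for x y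
      using that by blast
    then have "x - y = 0 *\<^sub>R 1" if "x \<in> z ` {..<n}" "y \<in> z ` {..<n}" for x y
      using that by simp
    then show ?thesis unfolding collinear_def by blast
  qed
  then show "z \<in> segments n" using assms by (simp add: segments_def)
qed

lemma segments_real_ratio:
  assumes "z \<in> segments n" "i < n" "j < n" "k < n"
  shows "(z k - z j) / (z i - z j) \<in> \<real>"
proof -
  have "Im ((z k - z j) * cnj (z i - z j)) = 0"
    using assms segments_iff[of z n] by (auto simp: segments_def)
  then show ?thesis by (rule Reals_divide_cnj)
qed

lemma polygons_distinct:
  assumes "z \<in> topspace (polygons n)" "n > 0"
  shows "\<exists>i<n. \<exists>j<n. z i \<noteq> z j"
proof (rule ccontr)
  assume "\<not> (\<exists>i<n. \<exists>j<n. z i \<noteq> z j)"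
  then have eq: "z i = z 0" if "i < n" for i using that assms(2) by blast
  have "z = (\<lambda>i\<in>{..<n}. z 0)"
  proof
    fix i
    show "z i = (\<lambda>i\<in>{..<n}. z 0) i"
      using assms(1) eq[of i] by (cases "i < n") (auto simp: topspace_polygons extensional_def)
  qed
  then have "z \<in> diag_points n" unfolding diag_points_def by blast
  with assms show False by (simp add: topspace_polygons)
qed

lemma real_polygon_polygons:
  assumes "n \<ge> 2" "x \<in> topspace (Euclidean_space (n - 1))" "x \<noteq> (\<lambda>_. 0)"
  shows "real_polygon n x \<in> topspace (polygons n)"
proof -
  have "real_polygon n x \<notin> diag_points n"
  proof
    assume "real_polygon n x \<in> diag_points n"
    then obtain b where "real_polygon n x = (\<lambda>i\<in>{..<n}. b)" by (auto simp: diag_points_def)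
    \<comment> \<open>A constant tuple is written as an affine image with factor 0, so that
      \<open>fourier_coords_affine\<close> makes its coordinates vanish.\<close>
    then have "real_polygon n x j = of_real 0 * (0 :: complex) + b" if "j < n" for j
      using that by simp
    then have "fourier_coords n (real_polygon n x) = (\<lambda>i. 0 * fourier_coords n (\<lambda>_. 0) i)"
      by (rule fourier_coords_affine)
    with assms show False by (simp add: fourier_coords_real_polygon)
  qed
  then show ?thesis by (simp add: topspace_polygons real_polygon_extensional)
qed

lemma nsphere_Euclidean_nonzero:
  assumes "n \<ge> 2" "x \<in> topspace (nsphere (n - 2))"
  shows "x \<in> topspace (Euclidean_space (n - 1))" "x \<noteq> (\<lambda>_. 0)"
  using assms by (auto simp: topspace_nsphere_eq)

lemma real_polygon_segments:
  assumes "n \<ge> 2" "x \<in> topspace (nsphere (n - 2))"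
  shows "real_polygon n x \<in> segments n"
proof -
  note x = nsphere_Euclidean_nonzero[OF assms]
  have "Im (real_polygon n x j) = 0" if "j < n" for j
    using real_polygon_real[OF x(1) that] by (simp add: complex_is_Real_iff)
  then show ?thesis
    using real_polygon_polygons[OF assms(1) x] by (simp add: segments_iff)
qed

text \<open>The polygon of the section is a nonzero real multiple of \<open>w\<close> minus its
  mean, and \<open>w\<close> is an affine image of \<open>z\<close>; so the class is
  unchanged.\<close>

lemma sphere_section:
  assumes n: "n \<ge> 2" and z: "z \<in> segments n" and ij: "i < n" "j < n" "z i \<noteq> z j"
  shows "sphere_section n i j z \<in> topspace (nsphere (n - 2))"
    and "eta n (real_polygon n (sphere_section n i j z)) = eta n z"
proof -
  define w where "w = (\<lambda>k. (z k - z j) / (z i - z j))"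
  define v where "v = fourier_coords n w"
  define c where "c = 1 / sqrt (\<Sum>i\<le>n - 2. v i ^ 2)"
  have sec: "sphere_section n i j z = normalized (n - 2) v"
    by (simp add: sphere_section_def v_def w_def)
  have w: "w k \<in> \<real>" if "k < n" for k
    using segments_real_ratio[OF z ij(1,2) that] by (simp add: w_def)
  have F: "real_polygon n v k = w k - dft n w 0" if "k < n" for k
    unfolding v_def using w that by (rule real_polygon_fourier_coords)
  have vE: "v \<in> topspace (Euclidean_space (n - 1))"
    unfolding v_def by (rule fourier_coords_Euclidean)
  \<comment> \<open>If \<open>v\<close> were 0, all \<open>w k\<close> would equal the mean, but
    \<open>w i = 1\<close> and \<open>w j = 0\<close>.\<close>
  have v0: "v \<noteq> (\<lambda>_. 0)"
  proof
    assume "v = (\<lambda>_. 0)"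
    then have "real_polygon n v k = 0" if "k < n" for k
      using real_polygon_scale[OF that, of 0 v] by simp
    then have "w i = w j" using F ij by (metis right_minus_eq)
    then show False using ij by (simp add: w_def)
  qed
  show sph: "sphere_section n i j z \<in> topspace (nsphere (n - 2))"
    unfolding sec using n vE v0 by (rule normalized_nsphere)
  have zp: "z \<in> topspace (polygons n)" using z by (simp add: segments_def)
  have "(\<Sum>i\<le>n - 2. v i ^ 2) > 0" by (rule sum_squares_pos[OF n vE v0])
  then have c: "c \<noteq> 0" by (simp add: c_def)
  have "sphere_section n i j z = (\<lambda>i. c * v i)" by (simp add: sec normalized_def c_def)
  then have "real_polygon n (sphere_section n i j z) k = of_real c * (w k - dft n w 0)" if "k < n" for k
    using that F by (simp only: real_polygon_scale)
  moreover have "of_real c * (w k - d) =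
      (of_real c / (z i - z j)) * z k + of_real c * (- z j / (z i - z j) - d)" for k d
    by (simp add: w_def diff_divide_distrib algebra_simps)
  ultimately have Fz: "real_polygon n (sphere_section n i j z) k =
      (of_real c / (z i - z j)) * z k + of_real c * (- z j / (z i - z j) - dft n w 0)" if "k < n" for k
    using that by metis
  have nz: "of_real c / (z i - z j) \<noteq> 0" using c ij by simp
  have "real_polygon n (sphere_section n i j z) \<in> topspace (polygons n)"
    using real_polygon_segments[OF n sph] by (simp add: segments_def)
  from eta_eq_iff[OF zp this] nz Fz
  have "eta n z = eta n (real_polygon n (sphere_section n i j z))" by blast
  then show "eta n (real_polygon n (sphere_section n i j z)) = eta n z" ..
qed

text \<open>The factor of an affine map between two real polygons is a quotient of differences of
  real vertices, hence a real \<open>r\<close>. It scales the Fourier coordinates, and unit length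
  forces \<open>r\<close> to be 1 or -1.\<close>

lemma eta_real_polygon_eq_iff:
  assumes n: "n \<ge> 2" and x: "x \<in> topspace (nsphere (n - 2))" and y: "y \<in> topspace (nsphere (n - 2))"
  shows "eta n (real_polygon n x) = eta n (real_polygon n y) \<longleftrightarrow> y = x \<or> y = (\<lambda>i. - x i)"
proof
  note xE = nsphere_Euclidean_nonzero[OF n x] and yE = nsphere_Euclidean_nonzero[OF n y]
  have p: "real_polygon n x \<in> topspace (polygons n)" "real_polygon n y \<in> topspace (polygons n)"
    using real_polygon_polygons[OF n] xE yE by auto
  show "y = x \<or> y = (\<lambda>i. - x i)"
    if "eta n (real_polygon n x) = eta n (real_polygon n y)"
  proof -
    have "\<exists>a b. a \<noteq> 0 \<and> (\<forall>j<n. real_polygon n y j = a * real_polygon n x j + b)"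
      using that by (simp only: eta_eq_iff[OF p])
    then obtain a b where "a \<noteq> 0 \<and> (\<forall>j<n. real_polygon n y j = a * real_polygon n x j + b)"
      by (elim exE)
    then have ab: "real_polygon n y j = a * real_polygon n x j + b" if "j < n" for j
      using that by simp
    obtain i j where ij: "i < n" "j < n" "real_polygon n x i \<noteq> real_polygon n x j"
      using polygons_distinct[OF p(1)] n by auto
    have "real_polygon n y i - real_polygon n y j = a * (real_polygon n x i - real_polygon n x j)"
      using ab ij by (simp add: algebra_simps)
    then have "a = (real_polygon n y i - real_polygon n y j) / (real_polygon n x i - real_polygon n x j)"
      using ij by simp
    also have "\<dots> \<in> \<real>"
      using ij xE yE by (intro Reals_divide Reals_diff real_polygon_real)
    finally obtain r where r: "a = of_real r" by (auto elim: Reals_cases)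
    have "fourier_coords n (real_polygon n y) = (\<lambda>i. r * fourier_coords n (real_polygon n x) i)"
      by (rule fourier_coords_affine) (use ab r in simp)
    then have yr: "y = (\<lambda>i. r * x i)" using xE yE by (simp add: fourier_coords_real_polygon)
    have "r\<^sup>2 * (\<Sum>i\<le>n - 2. x i ^ 2) = (\<Sum>i\<le>n - 2. y i ^ 2)"
      by (simp add: yr power_mult_distrib sum_distrib_left)
    then have "r\<^sup>2 = 1" using x y n by (simp add: topspace_nsphere_eq)
    then have "r = 1 \<or> r = - 1" by (simp add: power2_eq_1_iff)
    with yr show ?thesis by auto
  qed
  show "eta n (real_polygon n x) = eta n (real_polygon n y)" if "y = x \<or> y = (\<lambda>i. - x i)"
    using that
  proof
    assume y': "y = (\<lambda>i. - x i)"
    have "real_polygon n y j = (- 1) * real_polygon n x j + 0" if "j < n" for j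
      using real_polygon_scale[OF that, of "- 1" x] by (simp add: y')
    then show ?thesis unfolding eta_eq_iff[OF p] by (metis zero_neq_neg_one)
  qed simp
qed

lemma eta_real_polygon_topspace:
  assumes "n \<ge> 2" "x \<in> topspace (nsphere (n - 2))"
  shows "eta n (real_polygon n x) \<in> topspace (P_space n)"
  using real_polygon_segments[OF assms] by (auto simp: topspace_P_space segments_def)

lemma mu_eta_real_polygon:
  assumes "n \<ge> 2" "x \<in> topspace (nsphere (n - 2))"
  shows "mu n (eta n (real_polygon n x)) = eta n (real_polygon n (mat_act (R_mat n) x))"
  using real_polygon_segments[OF assms] nsphere_Euclidean_nonzero[OF assms] assms(1)
  by (simp add: segments_def mu_eta real_polygon_R_mat)

section \<open>Fibres\<close>

lemma mat_act_R_nu_group: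
  assumes "n \<ge> 2" "x \<in> topspace (nsphere (n - 2))" "g \<in> carrier (R_nu_group n)"
  shows "mat_act g x \<in> topspace (nsphere (n - 2))"
    and "orbit (R_nu_group n) mat_act (mat_act g x) = orbit (R_nu_group n) mat_act x"
proof -
  have "Suc (n - 2) = n - 1" using assms(1) by simp
  then show *: "mat_act g x \<in> topspace (nsphere (n - 2))"
    using assms R_nu_group_orthogonal[of n] mat_act_nsphere[of g "n - 2" x] by auto
  show "orbit (R_nu_group n) mat_act (mat_act g x) = orbit (R_nu_group n) mat_act x"
    using orbit_R_nu_group_eq_iff[OF assms(1,2) *] assms(3) by blast
qed

lemma R_nu_group_generators:
  assumes "n > 0"
  shows "R_mat n \<in> carrier (R_nu_group n)" "nu_mat n \<in> carrier (R_nu_group n)"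
  using assms by (auto simp: carrier_R_nu_group generate.incl)

lemma mat_act_nu_nsphere:
  assumes "n \<ge> 2" "x \<in> topspace (nsphere (n - 2))"
  shows "mat_act (nu_mat n) x = (\<lambda>i. - x i)"
  using nsphere_Euclidean_nonzero(1)[OF assms] by (rule mat_act_nu_mat)

lemma mat_act_inv:
  assumes n: "n \<ge> 2" and A: "A \<in> carrier (orthogonal_group (n - 1))"
    and x: "x \<in> topspace (nsphere (n - 2))"
  shows "mat_act A (mat_act (inv\<^bsub>orthogonal_group (n - 1)\<^esub> A) x) = x"
proof -
  interpret group "orthogonal_group (n - 1)" by (rule group_orthogonal_group)
  let ?B = "inv\<^bsub>orthogonal_group (n - 1)\<^esub> A"
  have B: "?B \<in> carrier (orthogonal_group (n - 1))" using A by (rule inv_closed)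
  have "A * ?B = 1\<^sub>m (n - 1)" using r_inv[OF A] by (simp add: orthogonal_group_def)
  moreover have "mat_act (A * ?B) x = mat_act A (mat_act ?B x)"
    using A B by (intro mat_act_mult[of _ "n - 1"]) (simp_all add: orthogonal_group_carrier)
  ultimately show ?thesis
    using mat_act_one[OF nsphere_Euclidean_nonzero(1)[OF n x]] by simp
qed

lemma BijGroup_mult_apply:
  assumes "g \<in> Bij S" "h \<in> Bij S" "p \<in> S"
  shows "(g \<otimes>\<^bsub>BijGroup S\<^esub> h) p = g (h p)"
  using assms by (simp add: BijGroup_def compose_def)

lemma inv_mu_mu:
  assumes "n > 0" "p \<in> topspace (P_space n)"
  shows "(inv\<^bsub>BijGroup (topspace (P_space n))\<^esub> mu n) (mu n p) = p"
proof -
  let ?B = "BijGroup (topspace (P_space n))"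
  interpret group ?B by (rule group_BijGroup)
  have carrier: "carrier ?B = Bij (topspace (P_space n))" by (simp add: BijGroup_def)
  have mu: "mu n \<in> carrier ?B" by (rule mu_in_Bij[OF assms(1)])
  have "(inv\<^bsub>?B\<^esub> mu n) (mu n p) = (inv\<^bsub>?B\<^esub> mu n \<otimes>\<^bsub>?B\<^esub> mu n) p"
    using inv_closed[OF mu] mu assms(2) unfolding carrier by (rule BijGroup_mult_apply[symmetric])
  also have "\<dots> = \<one>\<^bsub>?B\<^esub> p" by (simp only: l_inv[OF mu])
  also have "\<dots> = p" using assms(2) by (simp add: BijGroup_def)
  finally show ?thesis .
qed

text \<open>Elements of \<open>mu_group\<close> lift to the sphere along orbits of
  \<open>R_nu_group\<close>. The point \<open>x\<close> varies in the induction because, in a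
  product, the left factor acts on the lift obtained for the right one.\<close>

lemma mu_group_eta_real_polygon:
  assumes n: "n \<ge> 2" and g: "g \<in> carrier (mu_group n)" and x: "x \<in> topspace (nsphere (n - 2))"
  shows "\<exists>y\<in>topspace (nsphere (n - 2)). g (eta n (real_polygon n x)) = eta n (real_polygon n y) \<and>
    orbit (R_nu_group n) mat_act y = orbit (R_nu_group n) mat_act x"
proof -
  let ?B = "BijGroup (topspace (P_space n))" and ?O = "orthogonal_group (n - 1)"
  have n0: "n > 0" using n by simp
  note R = R_nu_group_generators(1)[OF n0]
  have "g \<in> generate ?B {mu n}" using g carrier_mu_group[OF n0] by simp
  then show ?thesis using x
  proof (induction arbitrary: x rule: generate.induct)
    case one
    then show ?case using eta_real_polygon_topspace[OF n]
      by (intro bexI[of _ x]) (simp_all add: BijGroup_def)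
  next
    case (incl h)
    then show ?case
      using mat_act_R_nu_group[OF n incl.prems R] mu_eta_real_polygon[OF n incl.prems] by auto
  next
    case (inv h)
    \<comment> \<open>Since \<open>R_mat n\<close> lifts \<open>mu n\<close>, its inverse lifts the
      inverse of \<open>mu n\<close>.\<close>
    let ?S = "inv\<^bsub>?O\<^esub> R_mat n"
    have S: "?S \<in> carrier (R_nu_group n)"
      by (auto simp: carrier_R_nu_group[OF n0] generate.inv)
    note y = mat_act_R_nu_group[OF n inv.prems S]
    have "mat_act (R_mat n) (mat_act ?S x) = x"
      using n inv.prems R_mat_orthogonal[OF n0] by (intro mat_act_inv)
    then have "mu n (eta n (real_polygon n (mat_act ?S x))) = eta n (real_polygon n x)"
      using mu_eta_real_polygon[OF n y(1)] by simp
    then have "(inv\<^bsub>?B\<^esub> mu n) (eta n (real_polygon n x)) = eta n (real_polygon n (mat_act ?S x))"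
      using inv_mu_mu[OF n0 eta_real_polygon_topspace[OF n y(1)]] by simp
    then show ?case using inv.hyps y by auto
  next
    case (eng g h)
    have Bij: "g \<in> Bij (topspace (P_space n))" "h \<in> Bij (topspace (P_space n))"
      using eng.hyps mu_group_subset[of n] carrier_mu_group[OF n0] by auto
    have "(g \<otimes>\<^bsub>?B\<^esub> h) (eta n (real_polygon n x)) = g (h (eta n (real_polygon n x)))"
      using Bij eta_real_polygon_topspace[OF n eng.prems] by (rule BijGroup_mult_apply)
    then show ?case using eng.IH eng.prems by metis
  qed
qed

text \<open>It suffices to check generators: \<open>R_mat n\<close> becomes \<open>mu n\<close>, and
  \<open>nu_mat n\<close> does not change the shape at all, -1 being the factor of an affine
  map.\<close>

lemma R_nu_group_eta_real_polygon:
  assumes n: "n \<ge> 2" and g: "g \<in> carrier (R_nu_group n)" and x: "x \<in> topspace (nsphere (n - 2))"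
  shows "orbit (mu_group n) (\<lambda>g. g) (eta n (real_polygon n (mat_act g x))) =
    orbit (mu_group n) (\<lambda>g. g) (eta n (real_polygon n x))"
proof -
  let ?O = "orthogonal_group (n - 1)"
  have n0: "n > 0" using n by simp
  note gens = R_nu_group_generators[OF n0]
  have inR: "h \<in> carrier (R_nu_group n)" if "h \<in> generate ?O {R_mat n, nu_mat n}" for h
    using that carrier_R_nu_group[OF n0] by simp
  have mu: "mu n \<in> carrier (mu_group n)"
    by (simp add: carrier_mu_group[OF n0] generate.incl)
  have gen_orbit: "orbit (mu_group n) (\<lambda>g. g) (eta n (real_polygon n (mat_act h x))) =
      orbit (mu_group n) (\<lambda>g. g) (eta n (real_polygon n x))"
    if h: "h \<in> {R_mat n, nu_mat n}" and x: "x \<in> topspace (nsphere (n - 2))" for h x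
  proof (cases "h = R_mat n")
    case True
    have hx: "mat_act h x \<in> topspace (nsphere (n - 2))"
      using mat_act_R_nu_group(1)[OF n x gens(1)] True by simp
    have "eta n (real_polygon n (mat_act h x)) = mu n (eta n (real_polygon n x))"
      using mu_eta_real_polygon[OF n x] True by simp
    with mu show ?thesis
      using orbit_mu_group_eq_iff[OF n0 eta_real_polygon_topspace[OF n x]
          eta_real_polygon_topspace[OF n hx]] by blast
  next
    case False
    then have "h = nu_mat n" using h by simp
    then have "mat_act h x = (\<lambda>i. - x i)" "mat_act h x \<in> topspace (nsphere (n - 2))"
      using mat_act_nu_nsphere[OF n x] mat_act_R_nu_group(1)[OF n x gens(2)] by auto
    then show ?thesis using eta_real_polygon_eq_iff[OF n x, of "mat_act h x"] by simp
  qed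
  have "g \<in> generate ?O {R_mat n, nu_mat n}" using g carrier_R_nu_group[OF n0] by simp
  then show ?thesis using x
  proof (induction arbitrary: x rule: generate.induct)
    case one
    then show ?case using mat_act_one[OF nsphere_Euclidean_nonzero(1)[OF n]]
      by (simp add: orthogonal_group_def)
  next
    case (incl h)
    then show ?case by (rule gen_orbit)
  next
    case (inv h)
    have "h \<in> carrier ?O"
      using inv.hyps R_mat_orthogonal[OF n0] nu_mat_orthogonal by auto
    then have "mat_act h (mat_act (inv\<^bsub>?O\<^esub> h) x) = x" using n inv.prems by (intro mat_act_inv)
    moreover have "mat_act (inv\<^bsub>?O\<^esub> h) x \<in> topspace (nsphere (n - 2))"
      using n inv.prems inR[OF generate.inv[OF inv.hyps]] by (rule mat_act_R_nu_group)
    \<comment> \<open>The generator case, taken at the preimage of \<open>x\<close> and read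
      backwards.\<close>
    ultimately show ?case using gen_orbit[OF inv.hyps, of "mat_act (inv\<^bsub>?O\<^esub> h) x"] by simp
  next
    case (eng g h)
    have "g \<in> carrier ?O" "h \<in> carrier ?O"
      using inR eng.hyps R_nu_group_orthogonal by blast+
    then have "mat_act (g \<otimes>\<^bsub>?O\<^esub> h) x = mat_act g (mat_act h x)"
      using mat_act_mult[of g "n - 1" h x]
      by (simp add: orthogonal_group_carrier) (simp add: orthogonal_group_def)
    moreover have "mat_act h x \<in> topspace (nsphere (n - 2))"
      using n eng.prems inR[OF eng.hyps(2)] by (rule mat_act_R_nu_group)
    ultimately show ?case using eng.IH eng.prems by simp
  qed
qed

lemma orbit_eta_real_polygon_eq_iff:
  assumes n: "n \<ge> 2" and x: "x \<in> topspace (nsphere (n - 2))" and y: "y \<in> topspace (nsphere (n - 2))"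
  shows "orbit (mu_group n) (\<lambda>g. g) (eta n (real_polygon n x)) =
      orbit (mu_group n) (\<lambda>g. g) (eta n (real_polygon n y)) \<longleftrightarrow>
    orbit (R_nu_group n) mat_act x = orbit (R_nu_group n) mat_act y"
proof
  have n0: "n > 0" using n by simp
  assume "orbit (mu_group n) (\<lambda>g. g) (eta n (real_polygon n x)) =
      orbit (mu_group n) (\<lambda>g. g) (eta n (real_polygon n y))"
  then obtain g where g: "g \<in> carrier (mu_group n)"
    "eta n (real_polygon n y) = g (eta n (real_polygon n x))"
    using orbit_mu_group_eq_iff[OF n0 eta_real_polygon_topspace[OF n x]
        eta_real_polygon_topspace[OF n y]] by blast
  obtain y' where y': "y' \<in> topspace (nsphere (n - 2))"
    "g (eta n (real_polygon n x)) = eta n (real_polygon n y')"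
    "orbit (R_nu_group n) mat_act y' = orbit (R_nu_group n) mat_act x"
    using mu_group_eta_real_polygon[OF n g(1) x] by blast
  \<comment> \<open>Points with the same labelled shape are equal or antipodal, and
    \<open>nu_mat n\<close> links antipodal points.\<close>
  then have "y = y' \<or> y = mat_act (nu_mat n) y'"
    using eta_real_polygon_eq_iff[OF n y'(1) y] g(2) mat_act_nu_nsphere[OF n y'(1)] by simp
  then have "orbit (R_nu_group n) mat_act y = orbit (R_nu_group n) mat_act y'"
    using mat_act_R_nu_group(2)[OF n y'(1) R_nu_group_generators(2)[OF n0]] by auto
  with y'(3) show "orbit (R_nu_group n) mat_act x = orbit (R_nu_group n) mat_act y" by simp
next
  assume "orbit (R_nu_group n) mat_act x = orbit (R_nu_group n) mat_act y"
  then obtain g where "g \<in> carrier (R_nu_group n)" "y = mat_act g x"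
    using orbit_R_nu_group_eq_iff[OF n x y] by blast
  then show "orbit (mu_group n) (\<lambda>g. g) (eta n (real_polygon n x)) =
      orbit (mu_group n) (\<lambda>g. g) (eta n (real_polygon n y))"
    using R_nu_group_eta_real_polygon[OF n _ x] by simp
qed

section \<open>Continuity\<close>

text \<open>Reduces continuity on abstract topologies to limits, where \<open>tendsto_intros\<close>
  applies.\<close>

lemma continuous_map_euclidean_iff_tendsto:
  "continuous_map X euclidean f \<longleftrightarrow> (\<forall>x\<in>topspace X. (f \<longlongrightarrow> f x) (atin X x))"
  by (simp add: continuous_map_atin)

lemma continuous_map_polygons_coordinate:
  "i < n \<Longrightarrow> continuous_map (polygons n) euclidean (\<lambda>z. z i)"
  unfolding polygons_def complex_space_def
  by (intro continuous_map_from_subtopology continuous_map_product_projection) simp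

lemma continuous_map_real_polygon:
  assumes "n \<ge> 2"
  shows "continuous_map (nsphere (n - 2)) (polygons n) (real_polygon n)"
proof -
  have "continuous_map (nsphere (n - 2)) euclidean (\<lambda>x. real_polygon n x j)" if "j < n" for j
    unfolding continuous_map_euclidean_iff_tendsto
  proof
    fix x assume "x \<in> topspace (nsphere (n - 2))"
    then have lim: "((\<lambda>x. x k) \<longlongrightarrow> x k) (atin (nsphere (n - 2)) x)" for k
      using continuous_map_nsphere_projection[of "n - 2" k]
      by (simp add: continuous_map_euclidean_iff_tendsto)
    have "((\<lambda>x. fourier_coeff n x k) \<longlongrightarrow> fourier_coeff n x k) (atin (nsphere (n - 2)) x)" for k
      unfolding fourier_coeff_def by (cases "2 * k \<le> n") (auto intro!: tendsto_intros lim)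
    then show "((\<lambda>x. real_polygon n x j) \<longlongrightarrow> real_polygon n x j) (atin (nsphere (n - 2)) x)"
      using that unfolding real_polygon_def by (auto intro!: tendsto_intros)
  qed
  then show ?thesis
    using real_polygon_polygons[OF assms] nsphere_Euclidean_nonzero[OF assms]
    unfolding polygons_def complex_space_def
    by (auto simp: continuous_map_in_subtopology continuous_map_componentwise
        real_polygon_extensional topspace_polygons)
qed

lemma tendsto_fourier_coords:
  assumes "n > 0" "\<And>k. k < n \<Longrightarrow> ((\<lambda>z. w z k) \<longlongrightarrow> v k) F"
  shows "((\<lambda>z. fourier_coords n (w z) i) \<longlongrightarrow> fourier_coords n v i) F"
proof -
  have dft: "((\<lambda>z. dft n (w z) k) \<longlongrightarrow> dft n v k) F" for k
    unfolding dft_def using assms by (auto intro!: tendsto_intros)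
  then show ?thesis unfolding fourier_coords_def by (auto intro!: tendsto_intros)
qed

lemma continuous_map_sphere_section:
  assumes n: "n \<ge> 2" and ij: "i < n" "j < n"
  shows "continuous_map (subtopology (polygons n) {z \<in> segments n. z i \<noteq> z j})
    (nsphere (n - 2)) (sphere_section n i j)"
proof -
  let ?X = "subtopology (polygons n) {z \<in> segments n. z i \<noteq> z j}"
  have top: "topspace ?X = {z \<in> segments n. z i \<noteq> z j}" by (auto simp: segments_def)
  have "continuous_map ?X euclideanreal (\<lambda>z. sphere_section n i j z m)" for m
    unfolding continuous_map_euclidean_iff_tendsto
  proof
    fix z assume "z \<in> topspace ?X"
    then have z: "z \<in> segments n" "z i \<noteq> z j" by (auto simp: top)
    let ?v = "fourier_coords n (\<lambda>k. (z k - z j) / (z i - z j))"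
    have "((\<lambda>z. z k) \<longlongrightarrow> z k) (atin ?X z)" if "k < n" for k
      using continuous_map_from_subtopology[OF continuous_map_polygons_coordinate[OF that]]
        \<open>z \<in> topspace ?X\<close> unfolding continuous_map_euclidean_iff_tendsto by blast
    then have lim: "((\<lambda>z. fourier_coords n (\<lambda>k. (z k - z j) / (z i - z j)) l) \<longlongrightarrow> ?v l) (atin ?X z)" for l
      using n ij z(2) by (intro tendsto_fourier_coords tendsto_intros) auto
    \<comment> \<open>The normalization divides by the root of this sum. Were it 0, division by zero
      would make the section 0, which is not on the sphere.\<close>
    have "(\<Sum>l\<le>n - 2. (?v l)\<^sup>2) \<noteq> 0"
    proof
      assume "(\<Sum>l\<le>n - 2. (?v l)\<^sup>2) = 0"
      then have "sphere_section n i j z = (\<lambda>_. 0)"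
        by (simp add: sphere_section_def normalized_def)
      then show False
        using sphere_section(1)[OF n z(1) ij z(2)] by (simp add: topspace_nsphere_eq[OF n])
    qed
    then show "((\<lambda>z. sphere_section n i j z m) \<longlongrightarrow> sphere_section n i j z m) (atin ?X z)"
      unfolding sphere_section_def normalized_def by (intro tendsto_intros lim) simp
  qed
  moreover have "sphere_section n i j z \<in> topspace (nsphere (n - 2))" if "z \<in> topspace ?X" for z
    using that top sphere_section(1)[OF n _ ij] by auto
  ultimately show ?thesis
    unfolding nsphere by (auto simp: continuous_map_in_subtopology continuous_map_componentwise_UNIV)
qed

section \<open>The projection restricted to segments\<close>

lemma closedin_segments: "closedin (polygons n) (segments n)"
proof -
  \<comment> \<open>A sum of squares gathers all equations of \<open>segments_iff\<close> into a
    single one.\<close>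
  define f where "f z = (\<Sum>i<n. \<Sum>j<n. \<Sum>k<n. (Im ((z k - z j) * cnj (z i - z j)))\<^sup>2)"
    for z :: "nat \<Rightarrow> complex"
  have "continuous_map (polygons n) euclideanreal f"
    unfolding continuous_map_euclidean_iff_tendsto
  proof
    fix z assume z: "z \<in> topspace (polygons n)"
    have "((\<lambda>z. z k) \<longlongrightarrow> z k) (atin (polygons n) z)" if "k < n" for k
      using continuous_map_polygons_coordinate[OF that] z
      unfolding continuous_map_euclidean_iff_tendsto by blast
    then show "(f \<longlongrightarrow> f z) (atin (polygons n) z)"
      unfolding f_def by (auto intro!: tendsto_intros)
  qed
  moreover have "segments n = {z \<in> topspace (polygons n). f z \<in> {0}}"
  proof -
    have "f z = 0 \<longleftrightarrow> (\<forall>i<n. \<forall>j<n. \<forall>k<n. Im ((z k - z j) * cnj (z i - z j)) = 0)" for z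
      by (simp add: f_def sum_nonneg_eq_0_iff sum_nonneg Ball_def del: complex_cnj_diff)
    moreover have "segments n \<subseteq> topspace (polygons n)" by (auto simp: segments_def)
    ultimately show ?thesis using segments_iff by auto
  qed
  ultimately show ?thesis using closedin_continuous_map_preimage[of _ _ f "{0}"] by auto
qed

text \<open>An affine map with factor \<open>a\<close> multiplies each expression in
  \<open>segments_iff\<close> by \<open>a * cnj a\<close>, a real number, so vanishing imaginary
  parts stay zero.\<close>

lemma segments_saturated: "{z \<in> topspace (polygons n). eta n z \<in> eta n ` segments n} = segments n"
proof
  show "segments n \<subseteq> {z \<in> topspace (polygons n). eta n z \<in> eta n ` segments n}"
    by (auto simp: segments_def)
  show "{z \<in> topspace (polygons n). eta n z \<in> eta n ` segments n} \<subseteq> segments n"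
  proof clarify
    fix z w assume z: "z \<in> topspace (polygons n)" and w: "w \<in> segments n" and eq: "eta n z = eta n w"
    have wp: "w \<in> topspace (polygons n)" using w by (simp add: segments_def)
    have "\<exists>a b. a \<noteq> 0 \<and> (\<forall>k<n. z k = a * w k + b)"
      using eq[symmetric] by (simp only: eta_eq_iff[OF wp z])
    then obtain a b where "a \<noteq> 0 \<and> (\<forall>k<n. z k = a * w k + b)" by (elim exE)
    then have zk: "z k = a * w k + b" if "k < n" for k using that by simp
    have "Im ((z k - z j) * cnj (z i - z j)) = 0" if "i < n" "j < n" "k < n" for i j k
    proof -
      have "(z k - z j) * cnj (z i - z j) = (a * cnj a) * ((w k - w j) * cnj (w i - w j))"
        using that by (simp add: zk algebra_simps)
      also have "a * cnj a = of_real ((norm a)\<^sup>2)" by (rule complex_norm_square[symmetric])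
      finally show ?thesis using w wp that by (simp add: segments_iff del: complex_cnj_diff)
    qed
    then show "z \<in> segments n" using z by (simp add: segments_iff)
  qed
qed

lemma quotient_map_eta: "quotient_map (polygons n) (P_space n) (eta n)"
  unfolding P_space_def orbit_space_def eta_def by (rule quotient_map_quotient_topology)

text \<open>A quotient map need not remain one on a subset; it does here because the segments form a
  closed saturated set.\<close>

lemma quotient_map_eta_segments:
  "quotient_map (subtopology (polygons n) (segments n))
     (subtopology (P_space n) (eta n ` segments n)) (eta n)"
proof (rule quotient_map_restriction[OF quotient_map_eta segments_saturated])
  have "eta n ` segments n \<subseteq> topspace (P_space n)"
    by (auto simp: topspace_P_space segments_def)
  moreover have "closedin (polygons n) {z \<in> topspace (polygons n). eta n z \<in> eta n ` segments n}"
    by (simp only: segments_saturated closedin_segments)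
  ultimately have "closedin (P_space n) (eta n ` segments n)"
    using quotient_map_eta[of n] unfolding quotient_map_closedin by blast
  then show "openin (P_space n) (eta n ` segments n) \<or> closedin (P_space n) (eta n ` segments n)" ..
qed

lemma quotient_map_eta_real_polygon:
  assumes n: "n \<ge> 2"
  shows "quotient_map (nsphere (n - 2)) (subtopology (P_space n) (eta n ` segments n))
    (\<lambda>x. eta n (real_polygon n x))"
proof -
  let ?S = "subtopology (polygons n) (segments n)"
  let ?Y = "subtopology (P_space n) (eta n ` segments n)"
  have topS: "topspace ?S = segments n" by (auto simp: segments_def)
  have topY: "topspace ?Y = eta n ` segments n"
    by (auto simp: topspace_P_space segments_def)
  have "continuous_map (nsphere (n - 2)) ?S (real_polygon n)"
    using continuous_map_real_polygon[OF n] real_polygon_segments[OF n]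
    by (auto simp: continuous_map_in_subtopology)
  then have cont: "continuous_map (nsphere (n - 2)) ?Y (\<lambda>x. eta n (real_polygon n x))"
    using continuous_map_compose[OF _ quotient_imp_continuous_map[OF quotient_map_eta_segments]]
    by (fastforce simp: o_def)
  have sect: "\<exists>i<n. \<exists>j<n. z i \<noteq> z j" if "z \<in> segments n" for z
    using that n by (intro polygons_distinct) (auto simp: segments_def)
  show ?thesis
    unfolding quotient_map_def
  proof (intro conjI allI impI iffI)
    show "(\<lambda>x. eta n (real_polygon n x)) ` topspace (nsphere (n - 2)) = topspace ?Y"
    proof
      show "(\<lambda>x. eta n (real_polygon n x)) ` topspace (nsphere (n - 2)) \<subseteq> topspace ?Y"
        using cont by (rule continuous_map_image_subset_topspace)
      show "topspace ?Y \<subseteq> (\<lambda>x. eta n (real_polygon n x)) ` topspace (nsphere (n - 2))"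
      proof
        fix p assume "p \<in> topspace ?Y"
        then obtain z where z: "z \<in> segments n" "p = eta n z" by (auto simp: topY)
        then obtain i j where ij: "i < n" "j < n" "z i \<noteq> z j" using sect by blast
        show "p \<in> (\<lambda>x. eta n (real_polygon n x)) ` topspace (nsphere (n - 2))"
          using sphere_section[OF n z(1) ij] z(2) by (intro image_eqI) auto
      qed
    qed
  next
    fix U assume "openin ?Y U"
    then show "openin (nsphere (n - 2)) {x \<in> topspace (nsphere (n - 2)). eta n (real_polygon n x) \<in> U}"
      by (rule openin_continuous_map_preimage[OF cont])
  next
    fix U assume U: "U \<subseteq> topspace ?Y"
    define V where "V = {x \<in> topspace (nsphere (n - 2)). eta n (real_polygon n x) \<in> U}"
    assume "openin (nsphere (n - 2)) {x \<in> topspace (nsphere (n - 2)). eta n (real_polygon n x) \<in> U}"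
    then have V: "openin (nsphere (n - 2)) V" by (simp add: V_def)
    \<comment> \<open>The section is continuous on the segments with \<open>z i\<close> and
      \<open>z j\<close> distinct, an open part of all segments, so pulling back \<open>V\<close>
      gives a set open among all segments.\<close>
    have op: "openin ?S {z \<in> segments n. z i \<noteq> z j \<and> sphere_section n i j z \<in> V}"
      if ij: "i < n" "j < n" for i j
    proof -
      let ?T = "{z \<in> segments n. z i \<noteq> z j}"
      have "continuous_map ?S euclidean (\<lambda>z. z i - z j)"
        using continuous_map_from_subtopology[OF continuous_map_polygons_coordinate[OF ij(1)], of "segments n"]
          continuous_map_from_subtopology[OF continuous_map_polygons_coordinate[OF ij(2)], of "segments n"]
        unfolding continuous_map_euclidean_iff_tendsto by (auto intro: tendsto_diff)
      from openin_continuous_map_preimage[OF this, of "- {0}"]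
      have "openin ?S {z \<in> topspace ?S. z i - z j \<in> - {0}}" by (simp add: open_Compl)
      then have T: "openin ?S ?T" unfolding topS by simp
      have topT: "topspace (subtopology ?S ?T) = ?T" by (auto simp: segments_def)
      have "subtopology ?S ?T = subtopology (polygons n) ?T"
        by (simp add: subtopology_subtopology Int_def conj_commute cong: conj_cong)
      then have "continuous_map (subtopology ?S ?T) (nsphere (n - 2)) (sphere_section n i j)"
        using continuous_map_sphere_section[OF n ij] by simp
      from openin_continuous_map_preimage[OF this V]
      have "openin (subtopology ?S ?T) {z \<in> segments n. z i \<noteq> z j \<and> sphere_section n i j z \<in> V}"
        unfolding topT by (simp add: conj_assoc)
      then show ?thesis using T by (rule openin_trans_full)
    qed
    \<comment> \<open>Every segment has two distinct vertices, and a section followed by the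
      projection returns its class; so these pieces make up the whole preimage of
      \<open>U\<close>.\<close>
    have "{z \<in> segments n. eta n z \<in> U} =
        (\<Union>i<n. \<Union>j<n. {z \<in> segments n. z i \<noteq> z j \<and> sphere_section n i j z \<in> V})" (is "?L = ?R")
    proof (intro equalityI subsetI)
      fix z assume z: "z \<in> ?L"
      then obtain i j where ij: "i < n" "j < n" "z i \<noteq> z j" using sect by blast
      then have "sphere_section n i j z \<in> V" using sphere_section[OF n _ ij] z by (simp add: V_def)
      with z ij show "z \<in> ?R" by blast
    next
      fix z assume "z \<in> ?R"
      then obtain i j where "i < n" "j < n" "z \<in> segments n" "z i \<noteq> z j" "sphere_section n i j z \<in> V"
        by blast
      then show "z \<in> ?L" using sphere_section(2)[OF n] by (simp add: V_def)
    qed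
    also have "openin ?S \<dots>" using op by (intro openin_Union) auto
    finally have "openin ?S {z \<in> topspace ?S. eta n z \<in> U}" by (simp only: topS)
    \<comment> \<open>Openness upstairs descends because \<open>eta n\<close> is a quotient map on
      segments.\<close>
    then show "openin ?Y U"
      using quotient_map_eta_segments[of n] U unfolding quotient_map_def by blast
  qed
qed

text \<open>Each map is constant on the fibres of the other, so each factors continuously through
  the other; surjectivity makes the two factors inverse to each other.\<close>

lemma homeomorphic_space_quotients:
  assumes f: "quotient_map X Y f" and g: "quotient_map X Z g"
    and eq: "\<And>x y. x \<in> topspace X \<Longrightarrow> y \<in> topspace X \<Longrightarrow> f x = f y \<longleftrightarrow> g x = g y"
  shows "Y homeomorphic_space Z"
proof -
  obtain h where h: "continuous_map Y Z h" "\<And>x. x \<in> topspace X \<Longrightarrow> h (f x) = g x"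
    using quotient_map_lift_exists[OF f quotient_imp_continuous_map[OF g]] eq by metis
  obtain k where k: "continuous_map Z Y k" "\<And>x. x \<in> topspace X \<Longrightarrow> k (g x) = f x"
    using quotient_map_lift_exists[OF g quotient_imp_continuous_map[OF f]] eq by metis
  have "homeomorphic_maps Y Z h k"
    unfolding homeomorphic_maps_def
    using h k quotient_imp_surjective_map[OF f] quotient_imp_surjective_map[OF g] by force
  then show ?thesis unfolding homeomorphic_space_def by blast
qed

theorem theorem5p4:
  fixes n :: nat
  assumes "n \<ge> 3"
  shows "segment_shape_space n homeomorphic_space spherical_orbifold n"
proof (rule homeomorphic_space_quotients)
  have n: "n \<ge> 2" using assms by simp
  \<comment> \<open>Two quotient maps are composed: the sphere onto labelled shapes, then division
    by \<open>mu_group\<close>.\<close>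
  show "quotient_map (nsphere (n - 2)) (segment_shape_space n)
      (orbit (mu_group n) (\<lambda>g. g) \<circ> (\<lambda>x. eta n (real_polygon n x)))"
    unfolding segment_shape_space_def orbit_space_def
    by (rule quotient_map_compose[OF quotient_map_eta_real_polygon[OF n] quotient_map_quotient_topology])
  show "quotient_map (nsphere (n - 2)) (spherical_orbifold n) (orbit (R_nu_group n) mat_act)"
    unfolding spherical_orbifold_def orbit_space_def by (rule quotient_map_quotient_topology)
  show "(orbit (mu_group n) (\<lambda>g. g) \<circ> (\<lambda>x. eta n (real_polygon n x))) x =
      (orbit (mu_group n) (\<lambda>g. g) \<circ> (\<lambda>x. eta n (real_polygon n x))) y \<longleftrightarrow>
    orbit (R_nu_group n) mat_act x = orbit (R_nu_group n) mat_act y"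
    if "x \<in> topspace (nsphere (n - 2))" "y \<in> topspace (nsphere (n - 2))" for x y
    using orbit_eta_real_polygon_eq_iff[OF n that] by simp
qed

end
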